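(* Let $\Gamma$ be a group that is nilpotent of class $\le n$, let $S\subseteq\Gamma\setminus\{\mathbb{I}\}$ be a generating set, $G:=\mathrm{Cay}(\Gamma,S)$, and let $r\ge\max\{2^{n+2},10\}$ be an integer. Let $h\in S$ be such that $\{\mathbb{I},h\}$ is an $r$-local $2$-separator of $G$, and suppose that $G$ has no $r$-local cutvertex. If $h$ is an involution, then the subgroup of $\Gamma$ generated by $h$ is normal.
   Context: Generating sets are closed under inverses; $\mathrm{Cay}(\Gamma,S)$ is the simple graph on $\Gamma$ with edges $\{g,gs\}$. $a\equiv b$ means $a=b$ or $a=b^{-1}$; $\Gamma$ is nilpotent of class $\le n$ if $[g,h]_n=\mathbb{I}$ for all $g\not\equiv h$, where $[g,h]_1=gh^{-1}g^{-1}h$ and $[g,h]_n$ is the reduced form of $g[g,h]_{n-1}^{-1}g^{-1}[g,h]_{n-1}$. Ball $B_r(v)$: subgraph of all vertices and edges on closed walks of length $\le r$ through $v$; $v$ is an $r$-local cutvertex if $B_r(v)-v$ is disconnected. For $X=\{v_0,v_1\}$, $N(X)$ is the set of vertices outside $X$ adjacent to $X$; the connectivity graph $C_r(v_0,v_1)$ has vertex set $N(X)$, $a,b$ adjacent if for some $i$ they lie in the same component of $B_r(v_i)-v_0-v_1$; $X$ is an $r$-local $2$-separator if $C_r(v_0,v_1)$ is disconnected and $d_G(v_0,v_1)\le r/2$. *)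

theory Defs
  imports "HOL-Algebra.Algebra"
begin

primrec itcomm :: "('a, 'b) monoid_scheme \<Rightarrow> 'a \<Rightarrow> 'a \<Rightarrow> nat \<Rightarrow> 'a" where
  "itcomm G g h 0 = h"
| "itcomm G g h (Suc k) =
     g \<otimes>\<^bsub>G\<^esub> inv\<^bsub>G\<^esub> (itcomm G g h k) \<otimes>\<^bsub>G\<^esub> inv\<^bsub>G\<^esub> g \<otimes>\<^bsub>G\<^esub> itcomm G g h k"

definition nilpotent_le :: "('a, 'b) monoid_scheme \<Rightarrow> nat \<Rightarrow> bool" where
  "nilpotent_le G n \<longleftrightarrow>
     (\<forall>g \<in> carrier G. \<forall>h \<in> carrier G.
        (g \<noteq> h \<and> g \<noteq> inv\<^bsub>G\<^esub> h) \<longrightarrow> itcomm G g h n = \<one>\<^bsub>G\<^esub>)"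

definition cay_adj :: "('a, 'b) monoid_scheme \<Rightarrow> 'a set \<Rightarrow> 'a \<Rightarrow> 'a \<Rightarrow> bool" where
  "cay_adj G S u w \<longleftrightarrow> u \<in> carrier G \<and> w \<in> carrier G \<and> (\<exists>s\<in>S. w = u \<otimes>\<^bsub>G\<^esub> s)"

text \<open>A walk is a nonempty vertex list with consecutive entries adjacent;
 its length is length xs - 1.\<close>
definition is_walk :: "('a \<Rightarrow> 'a \<Rightarrow> bool) \<Rightarrow> 'a list \<Rightarrow> bool" where
  "is_walk E xs \<longleftrightarrow> xs \<noteq> [] \<and> (\<forall>i. Suc i < length xs \<longrightarrow> E (xs ! i) (xs ! Suc i))"

definition closed_walk_through :: "('a \<Rightarrow> 'a \<Rightarrow> bool) \<Rightarrow> nat \<Rightarrow> 'a \<Rightarrow> 'a list \<Rightarrow> bool" where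
  "closed_walk_through E r v xs \<longleftrightarrow>
     is_walk E xs \<and> hd xs = last xs \<and> length xs \<le> Suc r \<and> v \<in> set xs"

definition ball_verts :: "('a \<Rightarrow> 'a \<Rightarrow> bool) \<Rightarrow> nat \<Rightarrow> 'a \<Rightarrow> 'a set" where
  "ball_verts E r v = {x. \<exists>xs. closed_walk_through E r v xs \<and> x \<in> set xs}"

definition ball_edges :: "('a \<Rightarrow> 'a \<Rightarrow> bool) \<Rightarrow> nat \<Rightarrow> 'a \<Rightarrow> 'a set set" where
  "ball_edges E r v = {{xs ! i, xs ! Suc i} | xs i. closed_walk_through E r v xs \<and> Suc i < length xs}"

definition ball_minus_adj :: "('a \<Rightarrow> 'a \<Rightarrow> bool) \<Rightarrow> nat \<Rightarrow> 'a \<Rightarrow> 'a set \<Rightarrow> 'a \<Rightarrow> 'a \<Rightarrow> bool" where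
  "ball_minus_adj E r v Z a b \<longleftrightarrow> {a, b} \<in> ball_edges E r v \<and> a \<notin> Z \<and> b \<notin> Z"

definition same_comp :: "('a \<Rightarrow> 'a \<Rightarrow> bool) \<Rightarrow> nat \<Rightarrow> 'a \<Rightarrow> 'a set \<Rightarrow> 'a \<Rightarrow> 'a \<Rightarrow> bool" where
  "same_comp E r v Z a b \<longleftrightarrow>
     a \<in> ball_verts E r v - Z \<and> b \<in> ball_verts E r v - Z \<and> rtranclp (ball_minus_adj E r v Z) a b"

definition local_cutvertex :: "('a \<Rightarrow> 'a \<Rightarrow> bool) \<Rightarrow> nat \<Rightarrow> 'a \<Rightarrow> bool" where
  "local_cutvertex E r v \<longleftrightarrow>
     (\<exists>a b. a \<in> ball_verts E r v - {v} \<and> b \<in> ball_verts E r v - {v} \<and>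
            \<not> same_comp E r v {v} a b)"

definition nbhd :: "('a \<Rightarrow> 'a \<Rightarrow> bool) \<Rightarrow> 'a set \<Rightarrow> 'a set" where
  "nbhd E Y = {a. a \<notin> Y \<and> (\<exists>y\<in>Y. E y a)}"

definition conn_adj :: "('a \<Rightarrow> 'a \<Rightarrow> bool) \<Rightarrow> nat \<Rightarrow> 'a \<Rightarrow> 'a \<Rightarrow> 'a \<Rightarrow> 'a \<Rightarrow> bool" where
  "conn_adj E r v0 v1 a b \<longleftrightarrow>
     a \<in> nbhd E {v0, v1} \<and> b \<in> nbhd E {v0, v1} \<and>
     (same_comp E r v0 {v0, v1} a b \<or> same_comp E r v1 {v0, v1} a b)"

definition dist_le_half :: "('a \<Rightarrow> 'a \<Rightarrow> bool) \<Rightarrow> nat \<Rightarrow> 'a \<Rightarrow> 'a \<Rightarrow> bool" where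
  "dist_le_half E r v0 v1 \<longleftrightarrow>
     (\<exists>xs. is_walk E xs \<and> hd xs = v0 \<and> last xs = v1 \<and> 2 * (length xs - 1) \<le> r)"

definition local_2_separator :: "('a \<Rightarrow> 'a \<Rightarrow> bool) \<Rightarrow> nat \<Rightarrow> 'a \<Rightarrow> 'a \<Rightarrow> bool" where
  "local_2_separator E r v0 v1 \<longleftrightarrow>
     v0 \<noteq> v1 \<and>
     (\<exists>a \<in> nbhd E {v0, v1}. \<exists>b \<in> nbhd E {v0, v1}. \<not> rtranclp (conn_adj E r v0 v1) a b) \<and>
     dist_le_half E r v0 v1"

end

theory Submission
  imports Defs
begin

text \<open>
  Since \<open>h\<close> is an involution, the translates of \<open>{\<one>, h}\<close> are the left cosets of \<open>\<langle>h\<rangle>\<close>, and each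
  of them is a local 2-separator whose two vertices are adjacent. Follow a short closed walk
  through the cosets and say that it crosses a coset when it enters from one side and leaves to the
  other, where a side is a union of components of the connectivity graph or its complement. The two
  vertices of a coset lie on the same side of every other coset, so crossings of different cosets
  do not interlace; an innermost pair of crossings of one coset therefore has no crossing in
  between, and the part of the word between them lies in \<open>{\<one>, h}\<close>.

  This is applied to three words that nilpotency makes trivial. Writing \<open>~\<close> for
  connectedness, the word of \<open>[h, g]_n\<close> yields \<open>g ~ h g\<close> for all generators \<open>g \<noteq> h\<close>, and
  \<open>[g, h]_n\<close> yields \<open>g ~ inv g\<close> for those not commuting with \<open>h\<close>. Given such a \<open>g\<close> and a
  generator \<open>x\<close> outside its component, \<open>[g, x]_n\<close> gives a contradiction. So \<open>h\<close> is central.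
\<close>

section \<open>Crossings of cyclic sequences\<close>

text \<open>Read \<open>C\<close> as the cyclic sequence of cosets and \<open>M Y Z\<close> as the
  side of \<open>Y\<close> on which \<open>Z\<close> lies. Take a closest pair of crossings of one
  coset; a crossing of another coset strictly between them would place the first coset on both of
  its sides.\<close>

lemma consecutive_equal_crossings:
  fixes C :: "nat \<Rightarrow> 'c" and M :: "'c \<Rightarrow> 'c \<Rightarrow> bool"
  assumes ne: "\<And>i. C (Suc i) \<noteq> C i"
    and const: "\<And>k i. C i \<noteq> C k \<Longrightarrow> C (Suc i) \<noteq> C k \<Longrightarrow> M (C k) (C i) = M (C k) (C (Suc i))"
    and per: "\<And>i. C (i + m) = C i" and "m > 0"
    and cr: "\<And>i. cr i \<longleftrightarrow> M (C (Suc i)) (C i) \<noteq> M (C (Suc i)) (C (Suc (Suc i)))"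
    and ex: "cr i0"
  obtains i j where "i < j" "cr i" "cr j" "C (Suc i) = C (Suc j)" "\<And>k. i < k \<Longrightarrow> k < j \<Longrightarrow> \<not> cr k"
proof -
  \<comment> \<open>The side relative to \<open>C k\<close> can change only at a crossing of
    \<open>C k\<close>.\<close>
  have label_const: "M (C k) (C a) = M (C k) (C b)"
    if "a \<le> b" "C a \<noteq> C k" "C b \<noteq> C k"
      "\<And>t. a \<le> t \<Longrightarrow> Suc t < b \<Longrightarrow> C (Suc t) = C k \<Longrightarrow> \<not> cr t" for k a b
    using that
  proof (induction "b - a" arbitrary: a rule: less_induct)
    case less
    show ?case
    proof (cases "a = b")
      case False
      then have ab: "a < b" using less.prems by simp
      \<comment> \<open>The side of \<open>C k\<close> relative to itself carries no information, so
        a visit to \<open>C k\<close> is jumped over by advancing two indices at once.\<close>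
      show ?thesis
      proof (cases "C (Suc a) = C k")
        case False
        have "M (C k) (C (Suc a)) = M (C k) (C b)"
          by (rule less.hyps) (use ab False less.prems in auto)
        then show ?thesis using const[of a k] False less.prems by simp
      next
        case True
        then have sb: "Suc a < b" using ab less.prems(3) by (metis Suc_lessI)
        have "\<not> cr a" using less.prems(4)[of a] True sb by simp
        then have 1: "M (C k) (C a) = M (C k) (C (Suc (Suc a)))" using cr True by simp
        have "C (Suc (Suc a)) \<noteq> C k" using ne[of "Suc a"] True by simp
        then have "M (C k) (C (Suc (Suc a))) = M (C k) (C b)"
          by (intro less.hyps) (use sb less.prems in auto)
        then show ?thesis using 1 by simp
      qed
    qed simp
  qed
  define P where "P d \<longleftrightarrow> (\<exists>i. d > 0 \<and> cr i \<and> cr (i + d) \<and> C (Suc i) = C (Suc (i + d)))" for d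
  \<comment> \<open>The given crossing and its copy one period later are the witnesses.\<close>
  have "P m"
    unfolding P_def using ex per[of i0] per[of "Suc i0"] per[of "Suc (Suc i0)"] cr[of i0] cr[of "i0 + m"] \<open>m > 0\<close>
    by (intro exI[of _ i0]) simp
  then obtain d where d: "P d" and least: "\<And>e. e < d \<Longrightarrow> \<not> P e"
    using exists_least_iff[of P] by blast
  obtain i where i: "d > 0" "cr i" "cr (i + d)" "C (Suc i) = C (Suc (i + d))"
    using d unfolding P_def by blast
  have min': False if "cr a" "cr b" "C (Suc a) = C (Suc b)" "a < b" "b - a < d" for a b
  proof -
    have "P (b - a)" unfolding P_def by (intro exI[of _ a]) (use that in simp)
    then show False using least that by blast
  qed
  have "\<not> cr k" if k: "i < k" "k < i + d" for k
  proof
    assume c: "cr k"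
    have "k - i < d" using k by linarith
    then have Y: "C (Suc i) \<noteq> C (Suc k)" using min'[OF i(2) c _ k(1)] by blast
    \<comment> \<open>By minimality \<open>k\<close> is the only crossing of its coset in this
      range, so sides of that coset are constant up to \<open>k\<close> and again after
      \<open>k\<close>.\<close>
    have only: "\<not> cr t" if "C (Suc t) = C (Suc k)" "i < t" "t < i + d" "t \<noteq> k" for t
    proof
      assume "cr t"
      have "k - t < d" "t - k < d" using that k by linarith+
      then show False using min'[OF \<open>cr t\<close> c] min'[OF c \<open>cr t\<close>] that by (metis linorder_neqE_nat)
    qed
    have "M (C (Suc k)) (C (Suc i)) = M (C (Suc k)) (C k)"
      by (rule label_const) (use k Y ne[of k] only in auto)
    moreover have "M (C (Suc k)) (C (Suc (Suc k))) = M (C (Suc k)) (C (Suc (i + d)))"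
      by (rule label_const) (use k Y i(4) ne[of "Suc k"] only in auto)
    ultimately show False using c i(4) cr[of k] by simp
  qed
  with i that[of i "i + d"] show ?thesis by auto
qed

section \<open>Local separators in Cayley graphs\<close>

lemma ball_edgeI:
  assumes "(E ^^ a) v z" "E z z'" "(E ^^ b) z' v" "a + b < r"
  shows "{z, z'} \<in> ball_edges E r v"
proof -
  obtain f where f: "f 0 = v" "f a = z" "\<And>i. i < a \<Longrightarrow> E (f i) (f (Suc i))"
    using assms(1) by (auto simp: relpowp_fun_conv)
  obtain f' where f': "f' 0 = z'" "f' b = v" "\<And>i. i < b \<Longrightarrow> E (f' i) (f' (Suc i))"
    using assms(3) by (auto simp: relpowp_fun_conv)
  \<comment> \<open>The closed walk goes from \<open>v\<close> to \<open>z\<close>, across the edge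
    and back: \<open>a + b + 2\<close> vertices, hence \<open>a + b + 1\<close> edges.\<close>
  define F where "F i = (if i \<le> a then f i else f' (i - Suc a))" for i
  define xs where "xs = map F [0..<Suc (Suc (a + b))]"
  have F: "E (F i) (F (Suc i))" if "i < Suc (a + b)" for i
  proof (cases i a rule: linorder_cases)
    case greater
    then have "Suc i - Suc a = Suc (i - Suc a)" "i - Suc a < b" using that by auto
    then show ?thesis using greater f'(3)[of "i - Suc a"] by (auto simp: F_def)
  qed (use that f f' assms(2) in \<open>auto simp: F_def\<close>)
  have len: "length xs = Suc (Suc (a + b))" by (simp add: xs_def)
  have nth: "xs ! i = F i" if "i < Suc (Suc (a + b))" for i
    unfolding xs_def using that by (subst nth_map) (auto simp del: upt_Suc)
  have "xs \<noteq> []" using len by auto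
  have "is_walk E xs" unfolding is_walk_def using \<open>xs \<noteq> []\<close> len nth F by auto
  moreover have "hd xs = v" "last xs = v"
    using \<open>xs \<noteq> []\<close> nth[of 0] nth[of "Suc (a + b)"] f f'
    by (auto simp: hd_conv_nth last_conv_nth len F_def)
  moreover have "v \<in> set xs" using \<open>hd xs = v\<close> \<open>xs \<noteq> []\<close> hd_in_set by fastforce
  ultimately have "closed_walk_through E r v xs"
    using assms(4) len by (simp add: closed_walk_through_def)
  moreover have "xs ! a = z" "xs ! Suc a = z'" using nth f f' by (auto simp: F_def)
  ultimately show ?thesis unfolding ball_edges_def using len by force
qed

lemma ball_edge_in_verts:
  assumes "{z, z'} \<in> ball_edges E r v" shows "z \<in> ball_verts E r v" 
proof -
  obtain xs i where "closed_walk_through E r v xs" "Suc i < length xs" "{z, z'} = {xs ! i, xs ! Suc i}"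
    using assms by (auto simp: ball_edges_def)
  moreover then have "z = xs ! i \<or> z = xs ! Suc i" by (auto simp: doubleton_eq_iff)
  ultimately show ?thesis
    by (auto simp: ball_verts_def intro!: exI[of _ xs])
qed

lemma same_comp_sym: "same_comp E r v Z a b \<Longrightarrow> same_comp E r v Z b a"
proof -
  have "symp (ball_minus_adj E r v Z)"
    by (auto simp: symp_def ball_minus_adj_def insert_commute)
  then show "same_comp E r v Z a b \<Longrightarrow> same_comp E r v Z b a"
    by (auto simp: same_comp_def dest: symp_rtranclp sympD)
qed

lemma same_comp_step:
  assumes "same_comp E r v Z a z" "{z, z'} \<in> ball_edges E r v" "z' \<notin> Z"
  shows "same_comp E r v Z a z'"
proof -
  have "z' \<in> ball_verts E r v" using assms(2) ball_edge_in_verts[of z' z] by (simp add: insert_commute)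
  moreover have "ball_minus_adj E r v Z z z'"
    using assms by (auto simp: ball_minus_adj_def same_comp_def)
  ultimately show ?thesis using assms by (auto simp: same_comp_def intro: rtranclp.rtrancl_into_rtrancl)
qed

lemma conn_adj_rtranclp_sym:
  "(conn_adj E r v0 v1)\<^sup>*\<^sup>* a b \<Longrightarrow> (conn_adj E r v0 v1)\<^sup>*\<^sup>* b a"
proof -
  have "symp (conn_adj E r v0 v1)"
    by (auto simp: symp_def conn_adj_def dest: same_comp_sym)
  then show "(conn_adj E r v0 v1)\<^sup>*\<^sup>* a b \<Longrightarrow> (conn_adj E r v0 v1)\<^sup>*\<^sup>* b a"
    by (auto dest: symp_rtranclp sympD)
qed

section \<open>Translation to the ball around the identity\<close>

locale cayley_involution = group G for G (structure) +
  fixes S :: "'a set" and h :: 'a and r :: nat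
  assumes S_sub: "S \<subseteq> carrier G - {\<one>}"
    and S_inv: "s \<in> S \<Longrightarrow> inv s \<in> S"
    and h_S: "h \<in> S"
    and h_sq [simp]: "h \<otimes> h = \<one>"
begin

abbreviation "E \<equiv> cay_adj G S"

lemma S_carrier [simp]: "s \<in> S \<Longrightarrow> s \<in> carrier G"
  using S_sub by blast

lemma h_carrier [simp]: "h \<in> carrier G"
  using h_S by simp

lemma h_inv [simp]: "inv h = h"
  using h_sq by (simp add: inv_equality)

lemma h_ne_one: "h \<noteq> \<one>"
  using h_S S_sub by blast

lemma h_cancel [simp]: "x \<in> carrier G \<Longrightarrow> x \<otimes> h \<otimes> h = x" "x \<in> carrier G \<Longrightarrow> h \<otimes> (h \<otimes> x) = x"
  using h_sq by (simp_all add: m_assoc) (simp add: m_assoc[symmetric])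

lemma adjI: "x \<in> carrier G \<Longrightarrow> s \<in> S \<Longrightarrow> E x (x \<otimes> s)"
  by (auto simp: cay_adj_def)

lemma adj_sym: "E x y \<Longrightarrow> E y x"
  using S_inv by (force simp: cay_adj_def m_assoc intro!: bexI[of _ "inv _"])

lemma adj_translate: "v \<in> carrier G \<Longrightarrow> E x y \<Longrightarrow> E (v \<otimes> x) (v \<otimes> y)"
  by (auto simp: cay_adj_def m_assoc)

lemma relpowp_adj_translate:
  "v \<in> carrier G \<Longrightarrow> (E ^^ k) x y \<Longrightarrow> (E ^^ k) (v \<otimes> x) (v \<otimes> y)"
  by (induction k arbitrary: y) (auto dest: adj_translate)

text \<open>Left multiplication by \<open>inv v\<close> is a graph automorphism, so what happens
  near any vertex can be read off in the single ball around \<open>\<one>\<close>.\<close>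

lemma ball_edge_translated:
  assumes "v \<in> carrier G" "(E ^^ a) v z" "E z z'" "(E ^^ b) z' v" "a + b < r"
  shows "{inv v \<otimes> z, inv v \<otimes> z'} \<in> ball_edges E r \<one>"
  using ball_edgeI[of a E "inv v \<otimes> v" "inv v \<otimes> z" "inv v \<otimes> z'" b r] assms
    relpowp_adj_translate[of "inv v"] adj_translate[of "inv v"] by (metis inv_closed l_inv)

lemma nbhd_iff: "a \<in> nbhd E {\<one>, h} \<longleftrightarrow> (\<exists>s\<in>S - {h}. a = s \<or> a = h \<otimes> s)"
proof
  assume "a \<in> nbhd E {\<one>, h}"
  then have a: "a \<noteq> \<one>" "a \<noteq> h" and "E \<one> a \<or> E h a" by (auto simp: nbhd_def)
  then show "\<exists>s\<in>S - {h}. a = s \<or> a = h \<otimes> s"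
    using h_sq by (auto simp: cay_adj_def)
next
  assume "\<exists>s\<in>S - {h}. a = s \<or> a = h \<otimes> s"
  then obtain s where s: "s \<in> S" "s \<noteq> h" "a = s \<or> a = h \<otimes> s" by blast
  have "s \<noteq> \<one>" using s S_sub by blast
  moreover have "h \<otimes> s \<noteq> \<one>"
    using s inv_equality[of h s] h_inv by (metis S_carrier h_carrier inv_inv)
  ultimately have "h \<otimes> s \<noteq> h" "h \<otimes> s \<noteq> \<one>" "s \<noteq> \<one>"
    using s by auto
  moreover have "E \<one> s" "E h (h \<otimes> s)" using adjI[of \<one> s] adjI[of h s] s by auto
  ultimately show "a \<in> nbhd E {\<one>, h}" using s by (auto simp: nbhd_def)
qed

lemma mult_in_nbhd: "t = \<one> \<or> t = h \<Longrightarrow> s \<in> S - {h} \<Longrightarrow> t \<otimes> s \<in> nbhd E {\<one>, h}"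
  unfolding nbhd_iff by (intro bexI[of _ s]) auto

lemma inv_in_S:
  assumes "s \<in> S - {h}" shows "inv s \<in> S - {h}"
proof -
  have "inv s \<noteq> h"
  proof
    assume "inv s = h"
    then have "inv (inv s) = h" by simp
    then show False using assms by simp
  qed
  then show ?thesis using assms S_inv by blast
qed

text \<open>These are the unions of components of the connectivity graph; such a \<open>K\<close>
  serves as one side of the separator.\<close>

definition comp_closed :: "'a set \<Rightarrow> bool" where
  "comp_closed K \<longleftrightarrow> K \<subseteq> nbhd E {\<one>, h} \<and> (\<forall>a\<in>K. \<forall>b. conn_adj E r \<one> h a b \<longrightarrow> b \<in> K)"

text \<open>The spacer \<open>c\<close> allows words in which \<open>h\<close> alternates with the letters \<open>s i\<close> (\<open>c = h\<close>)
  as well as words without \<open>h\<close> (\<open>c = \<one>\<close>). Each coset may be viewed from either of its two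
  vertices; \<open>cr_h\<close> says that the choice does not affect which passages are crossings. The slack
  4 in the length pays for detours along two coset edges.\<close>

lemma consecutive_crossings:
  fixes s u :: "nat \<Rightarrow> 'a"
  assumes K: "comp_closed K"
    and s: "\<And>i. s i \<in> S - {h}" and s_per: "\<And>i. s (i + m) = s i" and "m > 0"
    and u: "u 0 = \<one>" "\<And>i. u (Suc i) = u i \<otimes> s i \<otimes> c" "u m = \<one>"
    and c: "(c = \<one> \<and> m + 4 \<le> r) \<or> (c = h \<and> 2 * m + 4 \<le> r)"
    and cr: "\<And>i. cr i \<longleftrightarrow> (c \<otimes> inv s i \<in> K) \<noteq> (s (Suc i) \<in> K)"
    and cr_h: "\<And>i. cr i \<longleftrightarrow> (h \<otimes> c \<otimes> inv s i \<in> K) \<noteq> (h \<otimes> s (Suc i) \<in> K)"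
    and "cr i0"
  obtains i j where "i < j" "cr i" "cr j" "u (Suc j) \<in> {u (Suc i), u (Suc i) \<otimes> h}"
    "\<And>k. i < k \<Longrightarrow> k < j \<Longrightarrow> \<not> cr k"
proof -
  have s_S [simp]: "s i \<in> S" "s i \<noteq> h" "s i \<in> carrier G" "s i \<noteq> \<one>" for i
    using s[of i] S_sub by auto
  have c_carrier [simp]: "c \<in> carrier G" and c_sq: "c \<otimes> c = \<one>" using c h_sq by auto
  have u_carrier [simp]: "u i \<in> carrier G" for i by (induction i) (simp_all add: u)
  have u_per: "u (i + m) = u i" for i
    by (induction i) (simp_all add: u s_per)
  have u_mod: "u (i mod m) = u i" "s (i mod m) = s i" for i
  proof -
    have "u (j + k * m) = u j \<and> s (j + k * m) = s j" for j k
    proof (induction k)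
      case (Suc k)
      then show ?case using u_per[of "j + k * m"] s_per[of "j + k * m"] by (simp add: ac_simps)
    qed simp
    from this[of "i mod m" "i div m"] show "u (i mod m) = u i" "s (i mod m) = s i" by simp_all
  qed
  \<comment> \<open>The vertex reached after the letter \<open>s i\<close> and before the
    spacer.\<close>
  define w where "w i = u i \<otimes> s i" for i
  have w_carrier [simp]: "w i \<in> carrier G" for i by (simp add: w_def)
  have u_Suc: "u (Suc i) = w i \<otimes> c" for i by (simp add: w_def u)
  have E_uw: "E (u i) (w i)" for i unfolding w_def by (rule adjI) auto
  have E_h: "E x (x \<otimes> h)" "E (x \<otimes> h) x" if "x \<in> carrier G" for x
    using adjI[OF that h_S] adj_sym by auto
  \<comment> \<open>The number of edges in one step \<open>s i \<otimes> c\<close>: the spacer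
    \<open>\<one>\<close> costs none, the spacer \<open>h\<close> costs one.\<close>
  define l where "l = (if c = \<one> then 1 else 2::nat)"
  have l: "l * m + 4 \<le> r" "l > 0" using c h_ne_one by (auto simp: l_def)
  have w_to_u: "(E ^^ (l - 1)) (w i) (u (Suc i))" for i
    using c h_ne_one E_h(1)[of "w i"] by (auto simp: l_def u_Suc)
  have join: "(E ^^ (a + b)) x z" if "(E ^^ a) x y" "(E ^^ b) y z" for a b x y z
    using that by (auto simp: relpowp_add)
  have one: "(E ^^ Suc 0) x y" if "E x y" for x y
    using that by (simp add: eq_OO)
  have walk_step: "(E ^^ l) (u i) (u (Suc i))" for i
    using join[OF one[OF E_uw] w_to_u] l(2) by simp
  have walk: "(E ^^ (l * d)) (u i) (u (i + d))" for i d
  proof (induction d)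
    case (Suc d)
    then show ?case using join[OF Suc walk_step] by (simp add: add.commute)
  qed simp
  \<comment> \<open>The closed walk, started at \<open>u k\<close>, is split at its step from
    \<open>u i\<close>. Reducing both indices modulo \<open>m\<close> leaves two cases, according to
    which comes first.\<close>
  have around: "\<exists>a b. (E ^^ a) (u k) (u i) \<and> (E ^^ b) (u (Suc i)) (u k) \<and> a + l + b = l * m" for k i
  proof -
    have lt: "\<exists>a b. (E ^^ a) (u k) (u i) \<and> (E ^^ b) (u (Suc i)) (u k) \<and> a + l + b = l * m"
      if km: "k < m" and im: "i < m" for k i
    proof (cases "k \<le> i")
      case True
      then obtain d where d: "i = k + d" using le_Suc_ex by blast
      obtain e where e: "m = Suc i + e" using im by (metis Suc_leI le_Suc_ex)
      have "(E ^^ (l * (e + k))) (u (Suc i)) (u k)"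
        using walk[of "e + k" "Suc i"] u_per[of k] by (simp add: e ac_simps)
      then show ?thesis using walk[of d k] d e
        by (intro exI[of _ "l * d"] exI[of _ "l * (e + k)"]) (simp add: algebra_simps)
    next
      case False
      then obtain d where d: "k = Suc i + d" by (metis Suc_leI le_Suc_ex not_le)
      obtain e where e: "m = k + e" using km le_Suc_ex less_imp_le by blast
      have "(E ^^ (l * (e + i))) (u k) (u i)"
        using walk[of "e + i" k] u_per[of i] by (simp add: e ac_simps)
      then show ?thesis using walk[of d "Suc i"] d e
        by (intro exI[of _ "l * (e + i)"] exI[of _ "l * d"]) (simp add: algebra_simps)
    qed
    have "u (Suc (i mod m)) = u (Suc i)" by (simp add: u u_mod)
    then show ?thesis using lt[of "k mod m" "i mod m"] \<open>m > 0\<close> by (simp add: u_mod)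
  qed
  define C where "C i = {u i, u i \<otimes> h}" for i
  have w_C: "w i \<in> C (Suc i)" for i
    using c by (auto simp: C_def u_Suc)
  have C_carrier: "x \<in> carrier G" if "x \<in> C k" for x k using that by (auto simp: C_def)
  have C_eq: "C k = {x, x \<otimes> h}" if "x \<in> C k" for x k
    using that by (auto simp: C_def)
  have C_disj: "x \<notin> C k" if "C i \<noteq> C k" "x \<in> C i" for x i k
    using that C_eq by blast
  have C_walk: "\<exists>a. a \<le> 1 \<and> (E ^^ a) v (u k) \<and> (E ^^ a) (u k) v" if "v \<in> C k" for v k
  proof (cases "v = u k")
    case False
    then have "v = u k \<otimes> h" using that by (simp add: C_def)
    then show ?thesis using one[OF E_h(1)] one[OF E_h(2)] by (intro exI[of _ "Suc 0"]) simp
  qed (auto intro: exI[of _ "0::nat"])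
  \<comment> \<open>From either vertex \<open>v\<close> of a coset the whole walk and all coset
    edges along it are visible in the ball: \<open>v\<close> is at most one edge from
    \<open>u k\<close>, paid for once on leaving and once on returning.\<close>
  have edges: "{inv v \<otimes> u i, inv v \<otimes> w i} \<in> ball_edges E r \<one>"
    "{inv v \<otimes> u i, inv v \<otimes> (u i \<otimes> h)} \<in> ball_edges E r \<one>" if v: "v \<in> C k" for v k i
  proof -
    obtain a b where ab: "(E ^^ a) (u k) (u i)" "(E ^^ b) (u (Suc i)) (u k)" "a + l + b = l * m"
      using around by blast
    obtain d where d: "d \<le> 1" "(E ^^ d) v (u k)" "(E ^^ d) (u k) v" using C_walk[OF v] by blast
    have 1: "(E ^^ (d + a)) v (u i)" using join[OF d(2) ab(1)] .
    have 2: "(E ^^ (l - 1 + (b + d))) (w i) v" using join[OF w_to_u join[OF ab(2) d(3)]] .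
    show "{inv v \<otimes> u i, inv v \<otimes> w i} \<in> ball_edges E r \<one>"
      by (rule ball_edge_translated[OF _ 1 E_uw 2]) (use l ab(3) d(1) C_carrier[OF v] in auto)
    \<comment> \<open>The coset edge is traversed and retraced at once; with the two detours to
      \<open>v\<close> the closed walk has at most \<open>l * m + 4\<close> edges.\<close>
    have 3: "(E ^^ (1 + (l + (b + d)))) (u i \<otimes> h) v"
      using join[OF one[OF E_h(2)] join[OF walk_step join[OF ab(2) d(3)]]] by simp
    show "{inv v \<otimes> u i, inv v \<otimes> (u i \<otimes> h)} \<in> ball_edges E r \<one>"
      by (rule ball_edge_translated[OF _ 1 E_h(1) 3]) (use l ab(3) d(1) C_carrier[OF v] in auto)
  qed
  \<comment> \<open>The viewpoint depends only on the coset as a set, so repeated visits to a coset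
    assign the same sides.\<close>
  define rep where "rep Y = (SOME v. v \<in> Y)" for Y :: "'a set"
  have rep: "rep (C k) \<in> C k" for k unfolding rep_def by (rule someI[of _ "u k"]) (simp add: C_def)
  \<comment> \<open>After translation to \<open>\<one>\<close>, the vertex \<open>z\<close> lies in
    a component of the ball minus \<open>{\<one>, h}\<close> that meets \<open>K\<close>.\<close>
  define lbl where "lbl Y z \<longleftrightarrow> (\<exists>a\<in>K. same_comp E r \<one> {\<one>, h} a (inv rep Y \<otimes> z))" for Y z
  have off: "inv rep (C k) \<otimes> z \<notin> {\<one>, h}" if "z \<in> carrier G" "z \<notin> C k" for z k
  proof -
    have v: "rep (C k) \<in> carrier G" using rep C_carrier by blast
    show ?thesis
    proof
      assume "inv rep (C k) \<otimes> z \<in> {\<one>, h}"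
      then have "rep (C k) \<otimes> (inv rep (C k) \<otimes> z) \<in> {rep (C k) \<otimes> \<one>, rep (C k) \<otimes> h}" by auto
      then have "z \<in> {rep (C k), rep (C k) \<otimes> h}" using v that(1) by (simp add: m_assoc[symmetric])
      then show False using that(2) C_eq[OF rep[of k]] by blast
    qed
  qed
  have lbl_edge: "lbl (C k) z = lbl (C k) z'"
    if "{inv rep (C k) \<otimes> z, inv rep (C k) \<otimes> z'} \<in> ball_edges E r \<one>"
      "z \<in> carrier G" "z \<notin> C k" "z' \<in> carrier G" "z' \<notin> C k" for k z z'
  proof -
    have rev: "{inv rep (C k) \<otimes> z', inv rep (C k) \<otimes> z} \<in> ball_edges E r \<one>"
      using that(1) by (simp only: insert_commute)
    show ?thesis
      using same_comp_step[OF _ that(1) off[OF that(4,5)]] same_comp_step[OF _ rev off[OF that(2,3)]]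
      unfolding lbl_def by blast
  qed
  \<comment> \<open>For neighbours of the separator the side is just membership in \<open>K\<close>,
    because \<open>K\<close> is closed under adjacency in the connectivity graph.\<close>
  have lbl_K: "lbl (C k) z \<longleftrightarrow> inv rep (C k) \<otimes> z \<in> K"
    if "{inv rep (C k) \<otimes> z, y} \<in> ball_edges E r \<one>" "inv rep (C k) \<otimes> z \<in> nbhd E {\<one>, h}" for k z y
  proof
    assume "lbl (C k) z"
    then show "inv rep (C k) \<otimes> z \<in> K"
      using K that(2) unfolding lbl_def comp_closed_def conn_adj_def by blast
  next
    assume "inv rep (C k) \<otimes> z \<in> K"
    moreover have "same_comp E r \<one> {\<one>, h} (inv rep (C k) \<otimes> z) (inv rep (C k) \<otimes> z)"
      using ball_edge_in_verts[OF that(1)] that(2) by (auto simp: same_comp_def nbhd_def)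
    ultimately show "lbl (C k) z" unfolding lbl_def by blast
  qed
  define M where "M Y Z \<longleftrightarrow> (\<exists>z\<in>Z. lbl Y z)" for Y Z :: "'a set"
  \<comment> \<open>The edge inside the coset \<open>C i\<close> lies in the ball and avoids
    \<open>C k\<close>, so both vertices of \<open>C i\<close> are on the same side of
    \<open>C k\<close>.\<close>
  have M_eq: "M (C k) (C i) = lbl (C k) z" if "C i \<noteq> C k" "z \<in> C i" for k i z
  proof -
    have "lbl (C k) (u i) = lbl (C k) (u i \<otimes> h)"
      by (rule lbl_edge[OF edges(2)[OF rep]]) (use C_disj[OF that(1)] in \<open>auto simp: C_def\<close>)
    then show ?thesis using that(2) unfolding M_def by (auto simp: C_def)
  qed
  have C_ne: "C (Suc i) \<noteq> C i" for i
  proof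
    assume "C (Suc i) = C i"
    then have "w i \<in> {u i, u i \<otimes> h}" using w_C[of i] by (simp add: C_def)
    then show False using s_S[of i] by (auto simp: w_def r_cancel_one')
  qed
  have M_const: "M (C k) (C i) = M (C k) (C (Suc i))" if "C i \<noteq> C k" "C (Suc i) \<noteq> C k" for k i
  proof -
    have "lbl (C k) (u i) = lbl (C k) (w i)"
      by (rule lbl_edge[OF edges(1)[OF rep]])
        (use C_disj[OF that(1)] C_disj[OF that(2) w_C] in \<open>auto simp: C_def\<close>)
    then show ?thesis using M_eq[OF that(1), of "u i"] M_eq[OF that(2) w_C] by (simp add: C_def)
  qed
  have cr_M: "cr i \<longleftrightarrow> M (C (Suc i)) (C i) \<noteq> M (C (Suc i)) (C (Suc (Suc i)))" for i
  proof -
    let ?v = "rep (C (Suc i))"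
    \<comment> \<open>This records from which of its two vertices the coset is viewed:
      \<open>cr\<close> settles the case \<open>\<one>\<close> and \<open>cr_h\<close> the case
      \<open>h\<close>.\<close>
    define t where "t = inv ?v \<otimes> u (Suc i)"
    have v: "?v \<in> carrier G" using rep C_carrier by blast
    have t: "t = \<one> \<or> t = h"
    proof -
      have "u (Suc i) \<in> {?v, ?v \<otimes> h}" using C_eq[OF rep, of "Suc i"] by (auto simp: C_def)
      then show ?thesis using v by (auto simp: t_def m_assoc[symmetric])
    qed
    have w: "inv ?v \<otimes> w (Suc i) = t \<otimes> s (Suc i)"
      using v by (simp add: w_def t_def m_assoc)
    have u': "inv ?v \<otimes> u i = t \<otimes> c \<otimes> inv s i"
      using v c_sq by (simp add: t_def u m_assoc)
    have nb1: "t \<otimes> s (Suc i) \<in> nbhd E {\<one>, h}"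
      by (rule mult_in_nbhd[OF t s])
    have "t \<otimes> c = \<one> \<or> t \<otimes> c = h" using t c by auto
    then have nb2: "t \<otimes> c \<otimes> inv s i \<in> nbhd E {\<one>, h}"
      by (rule mult_in_nbhd[OF _ inv_in_S[OF s]])
    have "M (C (Suc i)) (C i) \<longleftrightarrow> inv ?v \<otimes> u i \<in> K"
      using M_eq[of i "Suc i" "u i"] C_ne[of i] lbl_K[OF edges(1)[OF rep]] nb2 u' by (auto simp: C_def)
    moreover have "{inv ?v \<otimes> w (Suc i), inv ?v \<otimes> u (Suc i)} \<in> ball_edges E r \<one>"
      using edges(1)[OF rep[of "Suc i"], of "Suc i"] by (simp add: insert_commute)
    then have "M (C (Suc i)) (C (Suc (Suc i))) \<longleftrightarrow> inv ?v \<otimes> w (Suc i) \<in> K"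
      using M_eq[OF C_ne w_C] lbl_K[of "Suc i" "w (Suc i)"] nb1 w by auto
    ultimately show ?thesis using t cr[of i] cr_h[of i] by (auto simp: u' w)
  qed
  have C_per: "C (i + m) = C i" for i by (simp add: C_def u_per)
  show ?thesis
  proof (rule consecutive_equal_crossings[OF C_ne M_const C_per \<open>m > 0\<close> cr_M \<open>cr i0\<close>])
    fix i j assume ij: "i < j" "cr i" "cr j" "C (Suc i) = C (Suc j)"
      and no: "\<And>k. i < k \<Longrightarrow> k < j \<Longrightarrow> \<not> cr k"
    have "u (Suc j) \<in> {u (Suc i), u (Suc i) \<otimes> h}" using ij(4) by (auto simp: C_def)
    then show ?thesis by (rule that[OF ij(1-3) _ no])
  qed
qed

end

section \<open>Commutator words\<close>

definition no_alternating_window :: "'c list \<Rightarrow> bool" where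
  "no_alternating_window xs \<longleftrightarrow>
     (\<forall>i. i + 3 < length xs \<longrightarrow> xs ! i = xs ! (i + 1) \<or> xs ! (i + 1) = xs ! (i + 2) \<or> xs ! (i + 2) = xs ! (i + 3))"

lemma no_alternating_window_Cons:
  "no_alternating_window (a # b # c # d # xs) \<longleftrightarrow> (a = b \<or> b = c \<or> c = d) \<and> no_alternating_window (b # c # d # xs)"
  (is "?l \<longleftrightarrow> ?r")
proof
  assume l: ?l
  have "no_alternating_window (b # c # d # xs)"
    unfolding no_alternating_window_def
  proof (intro allI impI)
    fix i assume "i + 3 < length (b # c # d # xs)"
    then show "(b # c # d # xs) ! i = (b # c # d # xs) ! (i + 1) \<or> (b # c # d # xs) ! (i + 1) = (b # c # d # xs) ! (i + 2) \<or>
      (b # c # d # xs) ! (i + 2) = (b # c # d # xs) ! (i + 3)"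
      using l[unfolded no_alternating_window_def, rule_format, of "Suc i"] by simp
  qed
  then show ?r using l[unfolded no_alternating_window_def, rule_format, of 0] by (simp add: numeral_2_eq_2 numeral_3_eq_3)
next
  assume r: ?r
  show ?l
    unfolding no_alternating_window_def
  proof (intro allI impI)
    fix i assume i: "i + 3 < length (a # b # c # d # xs)"
    show "(a # b # c # d # xs) ! i = (a # b # c # d # xs) ! (i + 1) \<or> (a # b # c # d # xs) ! (i + 1) = (a # b # c # d # xs) ! (i + 2) \<or>
      (a # b # c # d # xs) ! (i + 2) = (a # b # c # d # xs) ! (i + 3)"
    proof (cases i)
      case 0
      then show ?thesis using r by (simp add: numeral_2_eq_2 numeral_3_eq_3)
    next
      case (Suc j)
      then show ?thesis using r[unfolded no_alternating_window_def, THEN conjunct2, rule_format, of j] i by simp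
    qed
  qed
qed

lemma no_alternating_window_short: "length xs \<le> 3 \<Longrightarrow> no_alternating_window xs"
  by (simp add: no_alternating_window_def)

lemma no_alternating_window_map_rev:
  assumes "no_alternating_window xs" shows "no_alternating_window (map f (rev xs))"
  unfolding no_alternating_window_def
proof (intro allI impI)
  fix i assume i: "i + 3 < length (map f (rev xs))"
  define j where "j = length xs - (i + 4)"
  have j: "length xs - Suc i = j + 3" "length xs - Suc (i + 1) = j + 2" "length xs - Suc (i + 2) = j + 1"
    "length xs - Suc (i + 3) = j" "j + 3 < length xs"
    using i by (auto simp: j_def)
  have "xs ! j = xs ! (j + 1) \<or> xs ! (j + 1) = xs ! (j + 2) \<or> xs ! (j + 2) = xs ! (j + 3)"
    using assms j(5) unfolding no_alternating_window_def by blast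
  moreover have "map f (rev xs) ! i = f (xs ! (j + 3))" "map f (rev xs) ! (i + 1) = f (xs ! (j + 2))"
    "map f (rev xs) ! (i + 2) = f (xs ! (j + 1))" "map f (rev xs) ! (i + 3) = f (xs ! j)"
    using i j by (simp_all add: rev_nth del: add_2_eq_Suc' add_2_eq_Suc)
  ultimately show "map f (rev xs) ! i = map f (rev xs) ! (i + 1) \<or> map f (rev xs) ! (i + 1) = map f (rev xs) ! (i + 2) \<or>
      map f (rev xs) ! (i + 2) = map f (rev xs) ! (i + 3)"
    by auto
qed

text \<open>A window containing both copies of \<open>p\<close> has an equal pair; any other window
  lies in \<open>xs @ [p]\<close> or in \<open>p # ys\<close>.\<close>

lemma no_alternating_window_join:
  assumes "no_alternating_window (xs @ [p, p])" "no_alternating_window (p # ys)"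
  shows "no_alternating_window (xs @ p # p # ys)"
  using assms
proof (induction xs rule: induct_list012)
  case 1
  show ?case
  proof (cases ys)
    case (Cons a as)
    with 1 show ?thesis by (cases as) (auto simp: no_alternating_window_Cons no_alternating_window_short)
  qed (simp add: no_alternating_window_short)
next
  case (2 x)
  then have "no_alternating_window (p # p # ys)"
  proof (cases ys)
    case (Cons a as)
    with 2 show ?thesis by (cases as) (auto simp: no_alternating_window_Cons no_alternating_window_short)
  qed (simp add: no_alternating_window_short)
  then show ?case
    by (cases ys) (auto simp: no_alternating_window_Cons no_alternating_window_short)
next
  case (3 x y zs)
  show ?case
  proof (cases zs)
    case Nil
    then show ?thesis using 3 by (auto simp: no_alternating_window_Cons)
  next
    case (Cons z zs')
    show ?thesis
    proof (cases zs')
      case Nil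
      then show ?thesis using 3 Cons by (auto simp: no_alternating_window_Cons)
    next
      case (Cons z' zs'')
      then show ?thesis using 3 \<open>zs = z # zs'\<close> by (auto simp: no_alternating_window_Cons)
    qed
  qed
qed

section \<open>Spaced products and the words of iterated commutators\<close>

context group
begin

definition spaced_prod :: "'a \<Rightarrow> 'a list \<Rightarrow> 'a" where
  "spaced_prod c ws = foldr (\<lambda>a y. a \<otimes> c \<otimes> y) ws \<one>"

lemma spaced_prod_closed [simp]:
  "c \<in> carrier G \<Longrightarrow> set ws \<subseteq> carrier G \<Longrightarrow> spaced_prod c ws \<in> carrier G"
  by (induction ws) (auto simp: spaced_prod_def)

lemma spaced_prod_Nil [simp]: "spaced_prod c [] = \<one>"
  by (simp add: spaced_prod_def)

lemma spaced_prod_Cons [simp]: "spaced_prod c (a # ws) = a \<otimes> c \<otimes> spaced_prod c ws"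
  by (simp add: spaced_prod_def)

lemma spaced_prod_append:
  "c \<in> carrier G \<Longrightarrow> set xs \<subseteq> carrier G \<Longrightarrow> set ys \<subseteq> carrier G \<Longrightarrow>
    spaced_prod c (xs @ ys) = spaced_prod c xs \<otimes> spaced_prod c ys"
  by (induction xs) (auto simp: m_assoc)

lemma inv_cancel_left [simp]:
  "x \<in> carrier G \<Longrightarrow> y \<in> carrier G \<Longrightarrow> inv x \<otimes> (x \<otimes> y) = y"
  "x \<in> carrier G \<Longrightarrow> y \<in> carrier G \<Longrightarrow> x \<otimes> (inv x \<otimes> y) = y"
  by (simp_all add: m_assoc[symmetric])

text \<open>Inverting a spaced product puts the spacer in front of each letter instead of behind it;
  conjugation by the involution \<open>c\<close> shifts it back.\<close>

lemma spaced_prod_inv_rev: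
  assumes c: "c \<in> carrier G" "c \<otimes> c = \<one>" and ws: "set ws \<subseteq> carrier G"
  shows "spaced_prod c (map (m_inv G) (rev ws)) = c \<otimes> inv spaced_prod c ws \<otimes> c"
  using ws
proof (induction ws)
  case (Cons a ws)
  have "inv c = c" using c by (simp add: inv_equality)
  moreover have "map (m_inv G) (rev ws) @ [inv a] = map (m_inv G) (rev (a # ws))" by simp
  moreover have "set (map (m_inv G) (rev ws)) \<subseteq> carrier G" using Cons.prems by auto
  ultimately show ?case
    using Cons c spaced_prod_append[of c "map (m_inv G) (rev ws)" "[inv a]"]
    by (simp add: inv_mult_group m_assoc)
qed (use c in simp)

lemma spaced_walk:
  assumes "c \<in> carrier G" "set ws \<subseteq> carrier G"
  obtains u where "u 0 = \<one>" "\<And>i. u (Suc i) = u i \<otimes> ws ! (i mod length ws) \<otimes> c"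
    "u (length ws) = spaced_prod c ws"
proof -
  define u where "u = rec_nat \<one> (\<lambda>i y. y \<otimes> ws ! (i mod length ws) \<otimes> c)"
  have u: "u 0 = \<one>" "u (Suc i) = u i \<otimes> ws ! (i mod length ws) \<otimes> c" for i by (simp_all add: u_def)
  have "u i = spaced_prod c (take i ws)" if "i \<le> length ws" for i
    using that
  proof (induction i)
    case (Suc i)
    have "set (take i ws) \<subseteq> carrier G" "ws ! i \<in> carrier G"
      using assms Suc.prems set_take_subset[of i ws] nth_mem[of i ws] by auto
    then show ?case using Suc assms
      by (simp add: u take_Suc_conv_app_nth spaced_prod_append m_assoc)
  qed (simp add: u)
  from this[of "length ws"] u that show ?thesis by simp
qed

text \<open>The tail in the recursion reflects the cancellation of \<open>inv g\<close> against the leading letter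
  \<open>g\<close>.\<close>

primrec commutator_word :: "'a \<Rightarrow> 'a list \<Rightarrow> nat \<Rightarrow> 'a list" where
  "commutator_word g ws 0 = ws"
| "commutator_word g ws (Suc k) =
     g # map (m_inv G) (rev (commutator_word g ws k)) @ tl (commutator_word g ws k)"

lemma commutator_word_props:
  assumes "g \<in> carrier G" "set (tl ws) \<subseteq> carrier G" "hd ws = g" "ws \<noteq> []"
  shows "set (commutator_word g ws k) \<subseteq> carrier G \<and> hd (commutator_word g ws k) = g \<and>
    length (commutator_word g ws k) = length ws * 2 ^ k"
proof (induction k)
  case 0
  then show ?case using assms by (cases ws) auto
next
  case (Suc k)
  have "length ws * 2 ^ k \<noteq> 0" using assms by simp
  then show ?case using Suc assms(1) list.set_sel(2)[of "commutator_word g ws k"]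
    by (cases "commutator_word g ws k") auto
qed

text \<open>The index shifts by one because \<open>ws\<close> already spells the first commutator,
  whereas \<open>itcomm\<close> starts one level lower with \<open>x\<close> itself.\<close>

lemma spaced_prod_commutator_word:
  assumes c: "c \<in> carrier G" "c \<otimes> c = \<one>"
    and ws: "g \<in> carrier G" "set (tl ws) \<subseteq> carrier G" "hd ws = g" "ws \<noteq> []"
    and 1: "spaced_prod c ws = itcomm G g x (Suc 0)"
  shows "spaced_prod c (commutator_word g ws k) = itcomm G g x (Suc k)"
proof (induction k)
  case (Suc k)
  note props = commutator_word_props[OF ws, of k]
  have "length ws * 2 ^ k \<noteq> 0" using ws by simp
  then obtain t where t: "commutator_word g ws k = g # t"
    using props by (cases "commutator_word g ws k") auto
  have tc: "set t \<subseteq> carrier G" using props t by auto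
  have c_cancel: "c \<otimes> (c \<otimes> y) = y" if "y \<in> carrier G" for y
    using that c by (simp add: m_assoc[symmetric])
  have inv_c: "inv c = c" using c by (simp add: inv_equality)
  define P where "P = spaced_prod c (commutator_word g ws k)"
  have P: "P \<in> carrier G" using props c by (simp add: P_def)
  \<comment> \<open>Dropping the leading letter also drops its spacer, whence the extra
    \<open>c\<close>, which later cancels against the one from the inverted word.\<close>
  have T: "spaced_prod c t = c \<otimes> (inv g \<otimes> P)"
    using t tc c ws(1) by (simp add: P_def m_assoc c_cancel)
  have "set (map (m_inv G) (rev (commutator_word g ws k))) \<subseteq> carrier G" using props by auto
  then have "spaced_prod c (commutator_word g ws (Suc k)) =
      g \<otimes> c \<otimes> (spaced_prod c (map (m_inv G) (rev (commutator_word g ws k))) \<otimes> spaced_prod c t)"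
    using spaced_prod_append[of c "map (m_inv G) (rev (commutator_word g ws k))" t] tc c t by simp
  also have "\<dots> = g \<otimes> c \<otimes> (c \<otimes> inv P \<otimes> c \<otimes> (c \<otimes> (inv g \<otimes> P)))"
    using spaced_prod_inv_rev[OF c, of "commutator_word g ws k"] props T by (simp add: P_def)
  also have "\<dots> = g \<otimes> inv P \<otimes> inv g \<otimes> P"
    using P c ws(1) by (simp add: m_assoc c_cancel)
  finally show ?case using Suc by (simp add: P_def)
qed (use 1 in simp)

lemma commutator_word_alternates:
  assumes "g \<in> carrier G" "x \<in> carrier G"
    and "i < length (commutator_word g [g, inv x, inv g, x] k)"
  shows "commutator_word g [g, inv x, inv g, x] k ! i \<in> (if even i then {g, inv g} else {x, inv x})"
  using assms(3)
proof (induction k arbitrary: i)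
  case 0
  then have "i < 4" by simp
  then consider "i = 0" | "i = 1" | "i = 2" | "i = 3" by linarith
  then show ?case by cases auto
next
  case (Suc k)
  let ?w = "commutator_word g [g, inv x, inv g, x] k"
  have len: "length ?w = 4 * 2 ^ k"
    using commutator_word_props[of g "[g, inv x, inv g, x]" k] assms by simp
  have invs: "inv y \<in> {g, inv g}" if "y \<in> {g, inv g}" for y using that assms by auto
  have invs': "inv y \<in> {x, inv x}" if "y \<in> {x, inv x}" for y using that assms by auto
  show ?case
  proof (cases i)
    case (Suc j)
    show ?thesis
    proof (cases "j < length ?w")
      case True
      \<comment> \<open>Reversing a word of even length swaps the parities of positions, and the
        leading \<open>g\<close> shifts them back.\<close>
      have par: "even (length ?w - Suc j) \<longleftrightarrow> odd j" using True len by (auto simp: even_diff_nat)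
      have "commutator_word g [g, inv x, inv g, x] (Suc k) ! i = inv (?w ! (length ?w - Suc j))"
        using Suc True by (simp add: nth_append rev_nth)
      then show ?thesis
        using Suc.IH[of "length ?w - Suc j"] True par Suc invs[of "?w ! (length ?w - Suc j)"]
          invs'[of "?w ! (length ?w - Suc j)"] by (auto split: if_splits)
    next
      case False
      have lt: "Suc (j - length ?w) < length ?w" using Suc.prems Suc False by auto
      have "commutator_word g [g, inv x, inv g, x] (Suc k) ! i = ?w ! Suc (j - length ?w)"
        using Suc False lt by (simp add: nth_append nth_tl)
      moreover have "even (Suc (j - length ?w)) \<longleftrightarrow> even i" using Suc False len by auto
      ultimately show ?thesis using Suc.IH[OF lt] by simp
    qed
  qed simp
qed

text \<open>The walk of \<open>[g, h]_n\<close> crosses exactly between equal letters, so this bounds the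
  distance between consecutive crossings by 3.\<close>

lemma commutator_word_window:
  assumes g: "g \<in> carrier G"
  shows "\<exists>y z R Q. commutator_word g [g, inv g] (Suc k) = g # g # y # z # R \<and>
    commutator_word g [g, inv g] (Suc k) = g # Q @ [inv g, inv g] \<and> (y = g \<or> y = z) \<and>
    no_alternating_window (commutator_word g [g, inv g] (Suc k))"
proof (induction k)
  case 0
  have eq: "commutator_word g [g, inv g] (Suc 0) = [g, g, inv g, inv g]" using g by simp
  show ?case unfolding eq by (auto simp: no_alternating_window_Cons no_alternating_window_short)
next
  case (Suc k)
  define w where "w = commutator_word g [g, inv g] (Suc k)"
  obtain y z R Q where w1: "w = g # g # y # z # R" and w2: "w = g # Q @ [inv g, inv g]"
    and yz: "y = g \<or> y = z" and W: "no_alternating_window w"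
    using Suc w_def by blast
  define N where "N = map (m_inv G) (rev w)"
  have N1: "N = map (m_inv G) (rev R) @ [inv z, inv y, inv g, inv g]" by (simp add: N_def w1)
  have N2: "N = g # g # map (m_inv G) (rev Q) @ [inv g]" using g by (simp add: N_def w2)
  have w': "commutator_word g [g, inv g] (Suc (Suc k)) = g # N @ tl w" by (simp add: N_def w_def)
  have "no_alternating_window N" unfolding N_def by (rule no_alternating_window_map_rev[OF W])
  then have "no_alternating_window (g # N)"
    using no_alternating_window_join[of "[]" g "tl N"] N2 by (simp add: no_alternating_window_short)
  \<comment> \<open>The only new window is \<open>inv g\<close>, \<open>g\<close>, \<open>y\<close>,
    \<open>z\<close>; the condition on \<open>y\<close> is carried through the induction to provide
    an equal pair in it.\<close>
  moreover have "no_alternating_window (inv g # tl w)"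
    using W yz by (auto simp: w1 no_alternating_window_Cons)
  ultimately have "no_alternating_window (g # N @ tl w)"
    using no_alternating_window_join[of "g # map (m_inv G) (rev R) @ [inv z, inv y]" "inv g" "tl w"] N1 by simp
  moreover obtain y' R' where "map (m_inv G) (rev Q) @ [inv g] @ tl w = y' # R'"
    by (cases "map (m_inv G) (rev Q) @ [inv g] @ tl w") auto
  then have "g # N @ tl w = g # g # g # y' # R'" using N2 by simp
  moreover have "g # N @ tl w = g # (N @ Q) @ [inv g, inv g]" by (simp add: w2)
  ultimately show ?case unfolding w' by blast
qed

lemma commutator_word_window_cyclic:
  fixes k g defines "ws \<equiv> commutator_word g [g, inv g] (Suc k)"
  defines "s \<equiv> \<lambda>i. ws ! (i mod length ws)"
  assumes g: "g \<in> carrier G"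
  shows "s i = s (i + 1) \<or> s (i + 1) = s (i + 2) \<or> s (i + 2) = s (i + 3)"
proof -
  obtain y z R Q where w1: "ws = g # g # y # z # R" and w2: "ws = g # Q @ [inv g, inv g]"
    and yz: "y = g \<or> y = z" and W: "no_alternating_window ws"
    using commutator_word_window[OF g, of k] ws_def by blast
  \<comment> \<open>Appending the first three letters makes every window that wraps around the
    cyclic word an ordinary window.\<close>
  have W': "no_alternating_window (ws @ [g, g, y])"
    using no_alternating_window_join[of "g # Q" "inv g" "[g, g, y]"] W
    by (simp add: w2 no_alternating_window_Cons no_alternating_window_short)
  define L where "L = length ws"
  define t where "t = i mod L"
  have L: "L \<ge> 4" by (simp add: L_def w1)
  have t: "t < L" using L by (auto simp: t_def intro: mod_less_divisor)
  have nth: "s (i + d) = (ws @ [g, g, y]) ! (t + d)" if "d \<le> 3" for d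
  proof -
    have m: "(i + d) mod L = (t + d) mod L" by (simp add: t_def mod_add_left_eq)
    show ?thesis
    proof (cases "t + d < L")
      case True
      then show ?thesis using m by (simp add: s_def L_def[symmetric] nth_append)
    next
      case False
      define e where "e = t + d - L"
      have e: "t + d = e + L" "e < 3" using False t that by (auto simp: e_def)
      then have "s (i + d) = ws ! e" using m L by (simp add: s_def L_def[symmetric])
      moreover have "(ws @ [g, g, y]) ! (t + d) = [g, g, y] ! e"
        unfolding e(1) by (simp add: L_def nth_append)
      moreover have "e = 0 \<or> e = 1 \<or> e = 2" using e by linarith
      ultimately show ?thesis by (auto simp: w1)
    qed
  qed
  show ?thesis
    using W'[unfolded no_alternating_window_def, rule_format, of t] t nth[of 0] nth[of 1] nth[of 2] nth[of 3]
    by (simp add: L_def)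
qed

end

section \<open>Nilpotent groups\<close>

context group
begin

lemma eq_one_if_cube_and_power_two:
  assumes "x \<in> carrier G" "x \<otimes> x \<otimes> x = \<one>" "x [^] ((2::nat) ^ k) = \<one>"
  shows "x = \<one>"
proof -
  have "x [^] (3::nat) = \<one>" using assms by (simp add: numeral_3_eq_3)
  then have "ord x dvd 3" "ord x dvd 2 ^ k" using assms pow_eq_id by auto
  moreover have "coprime (3::nat) (2 ^ k)" by simp
  ultimately have "ord x = 1" using coprime_common_divisor_nat by blast
  then show ?thesis using assms ord_eq_1 by blast
qed

lemma generate_commute:
  assumes "A \<subseteq> carrier G" "y \<in> carrier G" "\<And>a. a \<in> A \<Longrightarrow> a \<otimes> y = y \<otimes> a" "x \<in> generate G A"
  shows "x \<otimes> y = y \<otimes> x"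
  using assms(4)
proof induction
  case (inv a)
  then have a: "a \<in> carrier G" "a \<otimes> y = y \<otimes> a" using assms by auto
  then have "inv a \<otimes> (a \<otimes> y) \<otimes> inv a = inv a \<otimes> (y \<otimes> a) \<otimes> inv a" by simp
  then show ?case using a(1) assms(2) by (simp add: m_assoc)
next
  case (eng x1 x2)
  then have "x1 \<in> carrier G" "x2 \<in> carrier G" using generate_in_carrier[OF assms(1)] by auto
  then show ?case using eng assms(2) by (metis m_assoc)
qed (use assms in auto)

end

section \<open>Nilpotency and the involution\<close>

locale nilpotent_cayley = cayley_involution +
  fixes n :: nat
  assumes n_pos: "1 \<le> n" and nilp: "nilpotent_le G n" and r_large: "2 ^ (n + 2) \<le> r"
begin

lemma itcomm_one: "g \<in> carrier G \<Longrightarrow> x \<in> carrier G \<Longrightarrow> g \<noteq> x \<Longrightarrow> g \<noteq> inv x \<Longrightarrow> itcomm G g x n = \<one>"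
  using nilp by (auto simp: nilpotent_le_def)

text \<open>Each closed walk traced by a commutator word below has \<open>2 ^ (n + 1)\<close> edges,
  and 4 is the slack required by \<open>consecutive_crossings\<close>.\<close>

lemma r_bounds: "2 ^ (n + 1) + 4 \<le> r" "8 \<le> r"
proof -
  have "(2::nat) ^ 2 \<le> 2 ^ (n + 1)" using n_pos by (intro power_increasing) auto
  then show "2 ^ (n + 1) + 4 \<le> r" "8 \<le> r" using r_large by auto
qed

text \<open>Conjugation by \<open>h\<close> inverts every commutator of this sequence, so the
  recursion becomes squaring.\<close>

lemma engel_power:
  assumes "g \<in> carrier G" "g \<noteq> h"
  shows "(inv g \<otimes> h \<otimes> g \<otimes> h) [^] ((2::nat) ^ (n - 1)) = \<one>"
proof -
  define d where "d = inv g \<otimes> h \<otimes> g \<otimes> h"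
  have d: "d \<in> carrier G" using assms by (simp add: d_def)
  have "itcomm G h g (Suc k) = inv d [^] ((2::nat) ^ k) \<and>
    h \<otimes> inv (itcomm G h g (Suc k)) \<otimes> h = itcomm G h g (Suc k)" for k
  proof (induction k)
    case 0
    then show ?case using assms by (simp add: d_def m_assoc inv_mult_group)
  next
    case (Suc k)
    define x where "x = itcomm G h g (Suc k)"
    have x: "x \<in> carrier G" using Suc d by (simp add: x_def del: itcomm.simps)
    have hx: "h \<otimes> inv x \<otimes> h = x" using Suc unfolding x_def by blast
    have s: "itcomm G h g (Suc (Suc k)) = x \<otimes> x"
      unfolding itcomm.simps(2)[of G h g "Suc k"] x_def[symmetric] h_inv hx ..
    have "h \<otimes> inv (x \<otimes> x) \<otimes> h = (h \<otimes> inv x \<otimes> h) \<otimes> (h \<otimes> inv x \<otimes> h)"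
      using x by (simp add: inv_mult_group m_assoc)
    also have "\<dots> = x \<otimes> x" by (simp only: hx)
    finally have "h \<otimes> inv (x \<otimes> x) \<otimes> h = x \<otimes> x" .
    moreover have "x \<otimes> x = inv d [^] ((2::nat) ^ Suc k)"
      using Suc d by (simp add: x_def nat_pow_mult mult_2 del: itcomm.simps)
    ultimately show ?case using s by simp
  qed
  from this[of "n - 1"] have "inv d [^] ((2::nat) ^ (n - 1)) = \<one>"
    using itcomm_one[of h g] assms n_pos by (simp del: itcomm.simps) (metis inv_inv h_inv)
  then show ?thesis using d by (simp add: d_def[symmetric] nat_pow_inv)
qed

section \<open>Short words that cannot return to the same coset\<close>

lemma segment_one:
  assumes "a \<in> S - {h}" shows "a \<otimes> h \<notin> {\<one>, h}"
proof
  assume "a \<otimes> h \<in> {\<one>, h}"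
  then have "a \<otimes> h \<otimes> h \<in> {h, \<one>}" using h_sq by auto
  then show False using assms S_sub by auto
qed

text \<open>The value \<open>\<one>\<close> would make \<open>a\<close> and \<open>h\<close>
  commute; the value \<open>h\<close> would make a conjugate of \<open>h\<close> trivial.\<close>

lemma segment_two:
  assumes "a \<in> S - {h}" "a \<otimes> h \<noteq> h \<otimes> a" shows "a \<otimes> h \<otimes> inv a \<otimes> h \<notin> {\<one>, h}"
proof
  have a: "a \<in> carrier G" using assms by simp
  assume *: "a \<otimes> h \<otimes> inv a \<otimes> h \<in> {\<one>, h}"
  show False
  proof (cases "a \<otimes> h \<otimes> inv a \<otimes> h = \<one>")
    case True
    have "a \<otimes> h = (a \<otimes> h \<otimes> inv a \<otimes> h) \<otimes> (h \<otimes> a)" using a by (simp add: m_assoc)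
    then show False using True assms(2) a by simp
  next
    case False
    then have **: "a \<otimes> h \<otimes> inv a \<otimes> h = h" using * by simp
    have "h = inv a \<otimes> ((a \<otimes> h \<otimes> inv a \<otimes> h) \<otimes> h) \<otimes> a" using a h_sq by (simp add: m_assoc)
    also have "\<dots> = \<one>" unfolding ** using a h_sq by simp
    finally show False using h_ne_one by simp
  qed
qed

text \<open>If the product lay in \<open>{\<one>, h}\<close>, then \<open>a\<close> and \<open>h\<close> would generate a
  symmetric group on three letters.\<close>

lemma segment_three:
  assumes "a \<in> S - {h}" shows "a \<otimes> h \<otimes> inv a \<otimes> h \<otimes> a \<otimes> h \<notin> {\<one>, h}"
proof
  have a: "a \<in> carrier G" "a \<noteq> h" "a \<noteq> \<one>" using assms S_sub by auto
  let ?w = "a \<otimes> h \<otimes> inv a \<otimes> h \<otimes> a \<otimes> h"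
  note pow = engel_power[OF a(1,2)]
  assume *: "?w \<in> {\<one>, h}"
  have aha: "h \<otimes> a \<otimes> h = a \<otimes> h \<otimes> inv ?w \<otimes> a"
    using a by (simp add: m_assoc inv_mult_group)
  show False
  proof (cases "?w = h")
    case True
    \<comment> \<open>Conjugation by \<open>h\<close> squares \<open>a\<close>; doing it twice gives
      the fourth power, so \<open>a\<close> has trivial cube, while the element in
      \<open>engel_power\<close> is \<open>a\<close> itself.\<close>
    then have e: "h \<otimes> a \<otimes> h = a \<otimes> a" using aha a by simp
    have "inv a \<otimes> h \<otimes> a \<otimes> h = inv a \<otimes> (h \<otimes> a \<otimes> h)" using a by (simp add: m_assoc)
    then have p: "a [^] ((2::nat) ^ (n - 1)) = \<one>" using pow e a by simp
    have "a = h \<otimes> (h \<otimes> a \<otimes> h) \<otimes> h" using a h_sq by (simp add: m_assoc)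
    also have "\<dots> = h \<otimes> (a \<otimes> a) \<otimes> h" by (simp only: e)
    also have "\<dots> = (h \<otimes> a \<otimes> h) \<otimes> (h \<otimes> a \<otimes> h)" using a by (simp add: m_assoc)
    also have "\<dots> = a \<otimes> (a \<otimes> a \<otimes> a)" unfolding e using a by (simp add: m_assoc)
    finally have "a \<otimes> a \<otimes> a = \<one>" using a by simp
    then show False using eq_one_if_cube_and_power_two[OF _ _ p] a by blast
  next
    case False
    then have "?w = \<one>" using * by simp
    then have e: "h \<otimes> a \<otimes> h = a \<otimes> h \<otimes> a" using aha a by simp
    have "inv a \<otimes> h \<otimes> a \<otimes> h = inv a \<otimes> (h \<otimes> a \<otimes> h)" using a by (simp add: m_assoc)
    also have "\<dots> = h \<otimes> a" unfolding e using a by (simp add: m_assoc)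
    finally have p: "(h \<otimes> a) [^] ((2::nat) ^ (n - 1)) = \<one>" using pow by simp
    \<comment> \<open>By the braid relation \<open>e\<close>, conjugating \<open>a\<close> by
      \<open>a \<otimes> h\<close> yields \<open>h\<close>, so \<open>a\<close> is an involution
      too; then \<open>h \<otimes> a\<close> has trivial cube.\<close>
    have "a \<otimes> h \<otimes> a \<otimes> h = h \<otimes> a" unfolding e[symmetric] using a by simp
    then have "a \<otimes> h \<otimes> a \<otimes> h \<otimes> inv a = h" using a by (simp add: m_assoc)
    then have hh: "(a \<otimes> h \<otimes> a \<otimes> h \<otimes> inv a) \<otimes> (a \<otimes> h \<otimes> a \<otimes> h \<otimes> inv a) = \<one>" using h_sq by simp
    have "a \<otimes> a = inv (a \<otimes> h) \<otimes> ((a \<otimes> h \<otimes> a \<otimes> h \<otimes> inv a) \<otimes> (a \<otimes> h \<otimes> a \<otimes> h \<otimes> inv a)) \<otimes> (a \<otimes> h)"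
      using a h_sq by (simp add: m_assoc inv_mult_group)
    also have "\<dots> = \<one>" unfolding hh using a by simp
    finally have aa: "a \<otimes> a = \<one>" .
    have "(h \<otimes> a) \<otimes> (h \<otimes> a) \<otimes> (h \<otimes> a) = (h \<otimes> a \<otimes> h) \<otimes> (a \<otimes> h \<otimes> a)" using a by (simp add: m_assoc)
    also have "\<dots> = a \<otimes> (h \<otimes> (a \<otimes> a) \<otimes> h) \<otimes> a" unfolding e using a by (simp add: m_assoc)
    also have "\<dots> = \<one>" using a aa h_sq by simp
    finally have "h \<otimes> a = \<one>" using eq_one_if_cube_and_power_two[OF _ _ p] a h_carrier by blast
    then have "h \<otimes> (h \<otimes> a) = h" by simp
    then show False using a by simp
  qed
qed

section \<open>Components of the connectivity graph\<close>

definition component :: "'a \<Rightarrow> 'a set" where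
  "component a = {b. (conn_adj E r \<one> h)\<^sup>*\<^sup>* a b}"

lemma component_closed: "a \<in> nbhd E {\<one>, h} \<Longrightarrow> comp_closed (component a)"
proof -
  assume a: "a \<in> nbhd E {\<one>, h}"
  have "b \<in> nbhd E {\<one>, h}" if "(conn_adj E r \<one> h)\<^sup>*\<^sup>* a b" for b
    using that a by (induction) (auto simp: conn_adj_def)
  then show ?thesis
    by (auto simp: comp_closed_def component_def intro: rtranclp.rtrancl_into_rtrancl)
qed

lemma component_self [simp]: "a \<in> component a"
  by (simp add: component_def)

lemma in_component_iff: "b \<in> component c \<Longrightarrow> b \<in> component a \<longleftrightarrow> c \<in> component a"
  by (auto simp: component_def dest: conn_adj_rtranclp_sym)

text \<open>If \<open>g\<close> and \<open>h\<close> commute, a four-cycle through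
  \<open>\<one>\<close>, \<open>g\<close>, \<open>h \<otimes> g\<close>, \<open>h\<close> supplies
  the edge. Otherwise, were the two vertices separated, every other passage of the closed walk from
  \<open>engel_power\<close> would be a crossing, leaving a segment of one or two letters.\<close>

lemma translate_in_component:
  assumes g: "g \<in> S - {h}" shows "h \<otimes> g \<in> component g"
proof (cases "g \<otimes> h = h \<otimes> g")
  case True
  have gc: "g \<in> carrier G" using g by simp
  have g_nb: "g \<in> nbhd E {\<one>, h}" "h \<otimes> g \<in> nbhd E {\<one>, h}" using g by (auto simp: nbhd_iff)
  have "(E ^^ Suc 0) \<one> g" "E g (g \<otimes> h)" using g adjI[of \<one> g] adjI[OF gc h_S] by (auto simp: eq_OO)
  moreover have "E (h \<otimes> g) h" using adj_sym[OF adjI[of h g]] g by simp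
  moreover have "E h \<one>" using adj_sym[OF adjI[of \<one> h]] h_S by simp
  ultimately have ed: "{g, h \<otimes> g} \<in> ball_edges E r \<one>"
    using ball_edgeI[of "Suc 0" E \<one> g "g \<otimes> h" "Suc (Suc 0)" r] r_bounds True by (auto simp: eq_OO)
  have "same_comp E r \<one> {\<one>, h} g g"
    using ball_edge_in_verts[OF ed] g_nb by (auto simp: same_comp_def nbhd_def)
  then have "same_comp E r \<one> {\<one>, h} g (h \<otimes> g)"
    using same_comp_step[OF _ ed] g_nb by (auto simp: nbhd_def)
  then show ?thesis using g_nb by (auto simp: component_def conn_adj_def)
next
  case nc: False
  show ?thesis
  proof (rule ccontr)
    assume not: "h \<otimes> g \<notin> component g"
    have gc: "g \<in> carrier G" "g \<noteq> h" using g by auto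
    define d where "d = inv g \<otimes> h \<otimes> g \<otimes> h"
    have d: "d \<in> carrier G" using gc by (simp add: d_def)
    define s where "s i = (if even i then inv g else g)" for i :: nat
    define u where "u i = d [^] (i div 2) \<otimes> (if even i then \<one> else inv g \<otimes> h)" for i :: nat
    \<comment> \<open>There are \<open>2 ^ (n - 1)\<close> factors \<open>d\<close>, each with two
      letters and two spacers.\<close>
    define m where "m = 2 * (2::nat) ^ (n - 1)"
    have m: "2 * m + 4 \<le> r" "m > 0"
      using r_bounds(1) n_pos by (auto simp: m_def power_Suc[symmetric] simp del: power_Suc)
    \<comment> \<open>Since \<open>inv s i = s (Suc i)\<close>, only the next letter decides whether
      a passage crosses.\<close>
    define cr where "cr i \<longleftrightarrow> (h \<otimes> s (Suc i) \<in> component g) \<noteq> (s (Suc i) \<in> component g)" for i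
    have s_Suc: "inv s i = s (Suc i)" for i using gc by (simp add: s_def)
    have s_S: "s i \<in> S - {h}" for i using g inv_in_S by (simp add: s_def)
    obtain i j where ij: "i < j" "cr i" "cr j" "u (Suc j) \<in> {u (Suc i), u (Suc i) \<otimes> h}"
      "\<And>k. i < k \<Longrightarrow> k < j \<Longrightarrow> \<not> cr k"
    proof (rule consecutive_crossings[of "component g" s m u h cr 0])
      show "comp_closed (component g)" using g by (intro component_closed) (auto simp: nbhd_iff)
      show "s (i + m) = s i" for i by (simp add: s_def m_def)
      show "u 0 = \<one>" by (simp add: u_def)
      show "u (Suc i) = u i \<otimes> s i \<otimes> h" for i
        using d gc by (auto simp: u_def s_def m_assoc) (auto simp: d_def m_assoc)
      show "u m = \<one>" using engel_power[OF gc] d by (simp add: u_def m_def d_def)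
      show "cr i \<longleftrightarrow> (h \<otimes> inv s i \<in> component g) \<noteq> (s (Suc i) \<in> component g)" for i
        by (simp add: cr_def s_Suc)
      show "cr i \<longleftrightarrow> (h \<otimes> h \<otimes> inv s i \<in> component g) \<noteq> (h \<otimes> s (Suc i) \<in> component g)" for i
        using s_S[of "Suc i"] h_sq by (auto simp: cr_def s_Suc)
      show "cr 0" using not by (simp add: cr_def s_def)
    qed (use s_S m in auto)
    have u_carrier: "u i \<in> carrier G" for i using d gc by (simp add: u_def)
    have u_Suc: "u (Suc i) = u i \<otimes> s i \<otimes> h" for i
      using d gc by (auto simp: u_def s_def m_assoc) (auto simp: d_def m_assoc)
    have seg: False if "u (Suc j) = u (Suc i) \<otimes> y" "y \<in> carrier G" "y \<notin> {\<one>, h}" for y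
      using that ij(4) u_carrier[of "Suc i"] by auto
    have cr_even: "cr k" if "even k" for k using not that by (simp add: cr_def s_def)
    define a where "a = s (Suc i)"
    have a: "a \<in> S - {h}" "a \<in> carrier G" using s_S by (auto simp: a_def)
    show False
    proof (cases "j = Suc i")
      case True
      then have "u (Suc j) = u (Suc i) \<otimes> (a \<otimes> h)"
        using u_Suc[of "Suc i"] u_carrier a by (simp add: a_def m_assoc)
      then show False by (rule seg[OF _ _ segment_one[OF a(1)]]) (use a in simp)
    next
      case False
      then have "\<not> cr (Suc i)" using ij by auto
      \<comment> \<open>A non-crossing passage has an odd index, which makes the first letter of the
        segment \<open>g\<close>, known not to commute with \<open>h\<close>.\<close>
      then have "even i" using cr_even[of "Suc i"] by auto
      then have "j = Suc (Suc i)" using ij(1,5) cr_even[of "Suc (Suc i)"] False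
        by (metis Suc_lessI even_Suc lessI less_Suc_eq)
      moreover have "s (Suc (Suc i)) = inv a" by (simp add: a_def s_Suc)
      ultimately have "u (Suc j) = u (Suc i) \<otimes> (a \<otimes> h \<otimes> inv a \<otimes> h)"
        using u_carrier a by (simp add: u_Suc[of "Suc i"] u_Suc[of "Suc (Suc i)"] a_def[symmetric] m_assoc)
      moreover have "a = g" using \<open>even i\<close> by (simp add: a_def s_def)
      ultimately show False using seg[OF _ _ segment_two[OF a(1)]] nc a by simp
    qed
  qed
qed

lemma translate_in_component_iff: "t \<in> S - {h} \<Longrightarrow> h \<otimes> t \<in> component a \<longleftrightarrow> t \<in> component a"
  using translate_in_component in_component_iff by blast

text \<open>A left factor \<open>h\<close> does not affect membership in a component, so the
  crossing criteria for both viewpoints and both spacers reduce to a single one about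
  letters.\<close>

lemma word_crossings:
  assumes g: "g \<in> S - {h}" and ws: "set ws \<subseteq> S - {h}" "ws \<noteq> []" "spaced_prod c ws = \<one>"
    and c: "(c = \<one> \<and> length ws + 4 \<le> r) \<or> (c = h \<and> 2 * length ws + 4 \<le> r)"
    and s: "\<And>i. s i = ws ! (i mod length ws)"
    and cr: "\<And>i. cr i \<longleftrightarrow> (inv s i \<in> component g) \<noteq> (s (Suc i) \<in> component g)"
    and "cr i0"
  obtains i j u where "i < j" "cr i" "cr j" "\<And>k. i < k \<Longrightarrow> k < j \<Longrightarrow> \<not> cr k"
    "\<And>k. u k \<in> carrier G" "\<And>k. u (Suc k) = u k \<otimes> s k \<otimes> c"
    "\<And>y. y \<in> carrier G \<Longrightarrow> u (Suc j) = u (Suc i) \<otimes> y \<Longrightarrow> y \<in> {\<one>, h}"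
proof -
  have cc: "c \<in> carrier G" using c by auto
  have wc: "set ws \<subseteq> carrier G" using ws by auto
  obtain u where u: "u 0 = \<one>" "\<And>i. u (Suc i) = u i \<otimes> s i \<otimes> c" "u (length ws) = \<one>"
    using spaced_walk[OF cc wc] ws(3) s by metis
  have s_S: "s i \<in> S - {h}" for i using ws s[of i] nth_mem[of "i mod length ws" ws] by (metis length_greater_0_conv mod_less_divisor subsetD)
  have u_carrier: "u i \<in> carrier G" for i by (induction i) (use u s_S cc in auto)
  have inv_sS: "inv s i \<in> S - {h}" for i using inv_in_S s_S by blast
  have inv_sc: "inv s i \<in> carrier G" for i using inv_sS by simp
  have inv_iff: "h \<otimes> inv s i \<in> component g \<longleftrightarrow> inv s i \<in> component g" for i
    by (rule translate_in_component_iff[OF inv_sS])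
  have s_iff: "h \<otimes> s i \<in> component g \<longleftrightarrow> s i \<in> component g" for i
    by (rule translate_in_component_iff[OF s_S])
  have c': "c = \<one> \<or> c = h" using c by blast
  obtain i j where ij: "i < j" "cr i" "cr j" "u (Suc j) \<in> {u (Suc i), u (Suc i) \<otimes> h}"
      "\<And>k. i < k \<Longrightarrow> k < j \<Longrightarrow> \<not> cr k"
  proof (rule consecutive_crossings[of "component g" s "length ws" u c cr i0])
    show "comp_closed (component g)" using g by (intro component_closed) (auto simp: nbhd_iff)
    show "s (i + length ws) = s i" for i by (simp add: s)
    show "cr i \<longleftrightarrow> (c \<otimes> inv s i \<in> component g) \<noteq> (s (Suc i) \<in> component g)" for i
      using c' by (elim disjE) (simp_all add: cr inv_iff inv_sc)
    show "cr i \<longleftrightarrow> (h \<otimes> c \<otimes> inv s i \<in> component g) \<noteq> (h \<otimes> s (Suc i) \<in> component g)" for i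
      using c' by (elim disjE) (simp_all add: cr inv_iff s_iff inv_sc)
    show "length ws > 0" using ws by simp
  qed (use s_S u c \<open>cr i0\<close> in blast)+
  show ?thesis
    by (rule that[OF ij(1-3,5) u_carrier u(2)]) (use ij(4) u_carrier in auto)
qed

text \<open>Otherwise the walk of \<open>[g, h]_n\<close> crosses exactly between equal letters.
  Between consecutive crossings the letters alternate, and at most three occur, so the three segment
  lemmas exclude every case.\<close>

lemma inverse_in_component:
  assumes g: "g \<in> S - {h}" and nc: "g \<otimes> h \<noteq> h \<otimes> g" shows "inv g \<in> component g"
proof (rule ccontr)
  assume not: "inv g \<notin> component g"
  have gc: "g \<in> carrier G" "g \<noteq> h" "inv g \<noteq> h" using g inv_in_S[OF g] by auto
  have g_ne: "g \<noteq> inv g" using not component_self by metis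
  have comm: "itcomm G g h n = \<one>" using gc itcomm_one[of g h] by simp
  \<comment> \<open>The word \<open>[g, inv g]\<close> of level one has no equal neighbours; equal
    neighbours appear from level two on.\<close>
  have "n \<noteq> 1"
  proof
    assume "n = 1"
    then have "g \<otimes> h \<otimes> inv g \<otimes> h = \<one>" using comm by simp
    then show False using segment_two[OF g nc] by simp
  qed
  then have "n = Suc (Suc (n - 2))" using n_pos by linarith
  then obtain k where k: "n = Suc (Suc k)" by blast
  define ws where "ws = commutator_word g [g, inv g] (Suc k)"
  have wl: "length ws = 2 * 2 ^ Suc k"
    using commutator_word_props[of g "[g, inv g]" "Suc k"] gc by (simp add: ws_def)
  have "set (commutator_word g [g, inv g] j) \<subseteq> {g, inv g}" for j
  proof (induction j)
    case (Suc j)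
    have "set (tl (commutator_word g [g, inv g] j)) \<subseteq> {g, inv g}"
      using Suc by (cases "commutator_word g [g, inv g] j") auto
    then show ?case using gc Suc by auto
  qed simp
  then have wset: "set ws \<subseteq> {g, inv g}" unfolding ws_def by blast
  have wprod: "spaced_prod h ws = \<one>"
  proof -
    have "spaced_prod h ws = itcomm G g h (Suc (Suc k))"
      unfolding ws_def by (rule spaced_prod_commutator_word) (use gc in \<open>simp_all add: m_assoc\<close>)
    then show ?thesis using comm by (simp only: k)
  qed
  define s where "s i = ws ! (i mod length ws)" for i
  have sv: "s i = g \<or> s i = inv g" for i
  proof -
    have "i mod length ws < length ws" using wl by simp
    then show ?thesis using wset nth_mem unfolding s_def by blast
  qed
  define cr where "cr i \<longleftrightarrow> s i = s (Suc i)" for i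
  have cr: "cr i \<longleftrightarrow> (inv s i \<in> component g) \<noteq> (s (Suc i) \<in> component g)" for i
    using sv[of i] sv[of "Suc i"] by (elim disjE) (simp_all add: cr_def gc not g_ne g_ne[symmetric])
  have window: "cr i \<or> cr (Suc i) \<or> cr (Suc (Suc i))" for i
    using commutator_word_window_cyclic[OF gc(1), of k i]
    unfolding ws_def[symmetric] s_def[symmetric] cr_def by (simp add: numeral_2_eq_2 numeral_3_eq_3)
  then obtain i0 where i0: "cr i0" by blast
  have len: "2 * length ws + 4 \<le> r" using r_bounds(1) by (simp add: wl k)
  obtain i j u where ij: "i < j" "cr i" "cr j" "\<And>k. i < k \<Longrightarrow> k < j \<Longrightarrow> \<not> cr k"
    and uc: "\<And>k. u k \<in> carrier G" and uS: "\<And>k. u (Suc k) = u k \<otimes> s k \<otimes> h"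
    and seg: "\<And>y. y \<in> carrier G \<Longrightarrow> u (Suc j) = u (Suc i) \<otimes> y \<Longrightarrow> y \<in> {\<one>, h}"
  proof (rule word_crossings[OF g _ _ wprod _ s_def cr i0])
    show "set ws \<subseteq> S - {h}" using wset g inv_in_S[OF g] by auto
    show "ws \<noteq> []" using wl by auto
  qed (use len in auto)
  define a where "a = s (Suc i)"
  have a: "a \<in> S - {h}" "a \<in> carrier G" using sv[of "Suc i"] g inv_in_S[OF g] by (auto simp: a_def)
  have anc: "a \<otimes> h \<noteq> h \<otimes> a"
  proof
    assume ah: "a \<otimes> h = h \<otimes> a"
    have "a = inv g" using sv[of "Suc i"] nc ah by (auto simp: a_def)
    then have "g \<otimes> (inv g \<otimes> h) \<otimes> g = g \<otimes> (h \<otimes> inv g) \<otimes> g" using ah by simp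
    then show False using gc nc by (simp add: m_assoc)
  qed
  have flip: "s (Suc k) = inv s k" if "\<not> cr k" for k
    using that sv[of k] sv[of "Suc k"] by (elim disjE) (simp_all add: cr_def gc)
  have le: "j \<le> k" if "cr k" "i < k" for k using ij(4) that not_le by blast
  have "j = Suc i \<or> j = Suc (Suc i) \<or> j = Suc (Suc (Suc i))"
    using window[of "Suc i"] le[of "Suc i"] le[of "Suc (Suc i)"] le[of "Suc (Suc (Suc i))"] ij(1) by auto
  moreover
  {
    assume "j = Suc i"
    then have "u (Suc j) = u (Suc i) \<otimes> (a \<otimes> h)" using uc a by (simp add: uS[of "Suc i"] a_def m_assoc)
    from seg[OF _ this] have False using segment_one[OF a(1)] a by simp
  }
  moreover
  {
    assume j: "j = Suc (Suc i)"
    then have "s (Suc (Suc i)) = inv a" using flip[of "Suc i"] ij(4)[of "Suc i"] by (simp add: a_def)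
    then have "u (Suc j) = u (Suc i) \<otimes> (a \<otimes> h \<otimes> inv a \<otimes> h)"
      using uc a j by (simp add: uS[of "Suc i"] uS[of "Suc (Suc i)"] a_def[symmetric] m_assoc)
    from seg[OF _ this] have False using segment_two[OF a(1) anc] a by simp
  }
  moreover
  {
    assume j: "j = Suc (Suc (Suc i))"
    then have s2: "s (Suc (Suc i)) = inv a" using flip[of "Suc i"] ij(4)[of "Suc i"] by (simp add: a_def)
    then have "s (Suc (Suc (Suc i))) = a" using flip[of "Suc (Suc i)"] ij(4)[of "Suc (Suc i)"] j a by simp
    then have "u (Suc j) = u (Suc i) \<otimes> (a \<otimes> h \<otimes> inv a \<otimes> h \<otimes> a \<otimes> h)"
      using uc a j s2
      by (simp add: uS[of "Suc i"] uS[of "Suc (Suc i)"] uS[of "Suc (Suc (Suc i))"] a_def[symmetric] m_assoc)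
    from seg[OF _ this] have False using segment_three[OF a(1)] a by simp
  }
  ultimately show False by blast
qed

end

section \<open>Centrality of the involution\<close>

context nilpotent_cayley
begin

definition centralizes :: "'a \<Rightarrow> bool" where
  "centralizes z \<longleftrightarrow> z \<in> carrier G \<and> z \<otimes> h = h \<otimes> z"

lemma centralizes_mult: "centralizes y \<Longrightarrow> centralizes z \<Longrightarrow> centralizes (y \<otimes> z)"
  unfolding centralizes_def by (metis h_carrier m_assoc m_closed)

lemma centralizes_inv: "centralizes z \<Longrightarrow> centralizes (inv z)"
  unfolding centralizes_def by (metis h_carrier inv_closed inv_mult_group h_inv)

lemma separator_imp_central:
  assumes sep: "a0 \<in> nbhd E {\<one>, h}" "b0 \<in> nbhd E {\<one>, h}" "\<not> (conn_adj E r \<one> h)\<^sup>*\<^sup>* a0 b0"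
    and g: "g \<in> S - {h}"
  shows "g \<otimes> h = h \<otimes> g"
proof (rule ccontr)
  assume nc: "g \<otimes> h \<noteq> h \<otimes> g"
  define K where "K = component g"
  have gK: "g \<in> K" "inv g \<in> K" using inverse_in_component[OF g nc] by (auto simp: K_def)
  \<comment> \<open>The connectivity graph is disconnected, so \<open>a0\<close> or
    \<open>b0\<close> lies outside \<open>K\<close>; dropping a possible factor \<open>h\<close>
    then gives a generator \<open>x\<close> outside \<open>K\<close>.\<close>
  obtain y where y: "y \<in> nbhd E {\<one>, h}" "y \<notin> K"
  proof (cases "a0 \<in> K")
    case True
    then have "b0 \<notin> K" using sep(3) conn_adj_rtranclp_sym unfolding K_def component_def
      by (metis (no_types, lifting) mem_Collect_eq rtranclp_trans)
    then show ?thesis using that sep by blast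
  qed (use that sep in blast)
  then obtain x where x: "x \<in> S - {h}" "y = x \<or> y = h \<otimes> x" using nbhd_iff by blast
  then have xK: "x \<notin> K" using y translate_in_component_iff[OF x(1)] by (auto simp: K_def)
  have gc: "g \<in> carrier G" and xc: "x \<in> carrier G" using g x by auto
  have ne: "g \<noteq> x" "inv g \<noteq> x" "g \<noteq> inv x" "inv g \<noteq> inv x" using gK xK gc xc by (auto simp: inv_inj)
  have comm: "itcomm G g x n = \<one>" using itcomm_one[OF gc xc ne(1,3)] .
  have "n = Suc (n - 1)" using n_pos by simp
  then obtain k where k: "n = Suc k" by blast
  define ws where "ws = commutator_word g [g, inv x, inv g, x] k"
  have wl: "length ws = 4 * 2 ^ k"
    using commutator_word_props[of g "[g, inv x, inv g, x]" k] gc xc by (simp add: ws_def)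
  have wprod: "spaced_prod \<one> ws = \<one>"
  proof -
    have "spaced_prod \<one> ws = itcomm G g x (Suc k)"
      unfolding ws_def by (rule spaced_prod_commutator_word) (use gc xc in \<open>simp_all add: m_assoc\<close>)
    then show ?thesis using comm by (simp only: k)
  qed
  define s where "s i = ws ! (i mod length ws)" for i
  have s_even: "s i = g \<or> s i = inv g" if "even i" for i
  proof -
    have "i mod length ws < length ws" "even (i mod length ws)" using that wl by (auto simp: dvd_mod_iff)
    then show ?thesis
      using commutator_word_alternates[OF gc xc, of "i mod length ws" k] by (simp add: s_def ws_def)
  qed
  have s_odd: "s i = x \<or> s i = inv x" if "odd i" for i
  proof -
    have "i mod length ws < length ws" "odd (i mod length ws)" using that wl by (auto simp: dvd_mod_iff)
    then show ?thesis
      using commutator_word_alternates[OF gc xc, of "i mod length ws" k] by (simp add: s_def ws_def)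
  qed
  have gS: "g \<in> S - {h}" "inv g \<in> S - {h}" "x \<in> S - {h}" "inv x \<in> S - {h}"
    using g x inv_in_S by auto
  have s_S: "s i \<in> S - {h}" for i
  proof (cases "even i")
    case True
    then show ?thesis using s_even[OF True] gS by metis
  next
    case False
    then show ?thesis using s_odd[OF False] gS by metis
  qed
  have sc: "s i \<in> carrier G" for i using s_S by simp
  have ws_S: "set ws \<subseteq> S - {h}"
  proof
    fix z assume "z \<in> set ws"
    then obtain i where "i < length ws" "z = ws ! i" by (auto simp: in_set_conv_nth)
    then show "z \<in> S - {h}" using s_S[of i] by (simp add: s_def)
  qed
  define cr where "cr i \<longleftrightarrow> (inv s i \<in> K) \<noteq> (s (Suc i) \<in> K)" for i
  have ex: "\<exists>i j u. i < j \<and> cr i \<and> cr j \<and> (\<forall>k. i < k \<longrightarrow> k < j \<longrightarrow> \<not> cr k) \<and>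
    (\<forall>k. u k \<in> carrier G) \<and> (\<forall>k. u (Suc k) = u k \<otimes> s k) \<and>
    (\<forall>y. y \<in> carrier G \<longrightarrow> u (Suc j) = u (Suc i) \<otimes> y \<longrightarrow> y \<in> {\<one>, h})" if cr0: "cr i0" for i0
  proof -
    have "ws \<noteq> []" using wl by auto
    moreover have "(\<one> = \<one> \<and> length ws + 4 \<le> r) \<or> (\<one> = h \<and> 2 * length ws + 4 \<le> r)"
      using r_bounds(1) by (simp add: wl k)
    ultimately obtain i j u where ij: "i < j" "cr i" "cr j" "\<And>k. i < k \<Longrightarrow> k < j \<Longrightarrow> \<not> cr k"
      and u: "\<And>k. u k \<in> carrier G" "\<And>k. u (Suc k) = u k \<otimes> s k \<otimes> \<one>"
      and seg: "\<And>y. y \<in> carrier G \<Longrightarrow> u (Suc j) = u (Suc i) \<otimes> y \<Longrightarrow> y \<in> {\<one>, h}"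
      using word_crossings[OF g ws_S _ wprod _ s_def cr_def[unfolded K_def] cr0] by blast
    have "u (Suc k) = u k \<otimes> s k" for k using u sc by simp
    then show ?thesis using ij u(1) seg by blast
  qed
  show False
  proof (cases "inv x \<in> K")
    case False
    \<comment> \<open>The letters \<open>g\<close>, \<open>inv g\<close> lie in \<open>K\<close> and
      \<open>x\<close>, \<open>inv x\<close> do not, so every passage crosses and the segment is a
      single letter.\<close>
    have all: "cr i" for i
    proof (cases "even i")
      case True
      then have "s (Suc i) = x \<or> s (Suc i) = inv x" using s_odd by simp
      with s_even[OF True] show ?thesis using False xK gK gc by (elim disjE) (simp_all add: cr_def)
    next
      case odd: False
      then have "s (Suc i) = g \<or> s (Suc i) = inv g" using s_even by simp
      with s_odd[OF odd] show ?thesis using False xK gK xc by (elim disjE) (simp_all add: cr_def)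
    qed
    obtain i j u where ij: "i < j" "\<And>k. i < k \<Longrightarrow> k < j \<Longrightarrow> \<not> cr k"
      and u: "\<And>k. u (Suc k) = u k \<otimes> s k"
      and seg: "\<And>y. y \<in> carrier G \<Longrightarrow> u (Suc j) = u (Suc i) \<otimes> y \<Longrightarrow> y \<in> {\<one>, h}"
      using ex[OF all] by blast
    have "j = Suc i" using ij all by (metis Suc_lessI lessI)
    then have "u (Suc j) = u (Suc i) \<otimes> s (Suc i)" using u by simp
    from seg[OF sc this] show False using s_S[of "Suc i"] S_sub by auto
  next
    case True
    \<comment> \<open>Here \<open>x\<close> and \<open>inv x\<close> are in different components,
      which \<open>inverse_in_component\<close> permits only if \<open>x\<close> commutes with
      \<open>h\<close>.\<close>
    have "x \<otimes> h = h \<otimes> x"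
    proof (rule ccontr)
      assume "x \<otimes> h \<noteq> h \<otimes> x"
      then have "inv x \<in> component x" using inverse_in_component[OF x(1)] by blast
      then show False using in_component_iff[of "inv x" x g] True xK by (simp add: K_def)
    qed
    then have x_cent: "centralizes x" "centralizes (inv x)"
      using xc centralizes_inv by (auto simp: centralizes_def)
    have x_ne: "x \<noteq> inv x" using True xK by metis
    \<comment> \<open>Each odd-indexed letter yields exactly one crossing: just before it if it is
      \<open>x\<close>, just after it if it is \<open>inv x\<close>. Hence a segment between
      consecutive crossings contains exactly one of the letters \<open>g\<close>,
      \<open>inv g\<close>.\<close>
    have cr_even: "cr i \<longleftrightarrow> s (Suc i) = x" if "even i" for i
    proof -
      have "s (Suc i) = x \<or> s (Suc i) = inv x" using s_odd that by simp
      with s_even[OF that] show ?thesis using gK xK True gc x_ne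
        by (elim disjE) (simp_all add: cr_def)
    qed
    have cr_odd: "cr i \<longleftrightarrow> s i = inv x" if "odd i" for i
    proof -
      have "s (Suc i) = g \<or> s (Suc i) = inv g" using s_even that by simp
      with s_odd[OF that] show ?thesis using gK xK True xc x_ne
        by (elim disjE) (simp_all add: cr_def)
    qed
    have "cr 0 \<or> cr 1" using cr_even[of 0] cr_odd[of 1] s_odd[of 1] by auto
    then obtain i0 where cr0: "cr i0" by blast
    obtain i j u where ij: "i < j" "cr i" "cr j" "\<And>k. i < k \<Longrightarrow> k < j \<Longrightarrow> \<not> cr k"
      and uc: "\<And>k. u k \<in> carrier G" and u: "\<And>k. u (Suc k) = u k \<otimes> s k"
      and seg: "\<And>y. y \<in> carrier G \<Longrightarrow> u (Suc j) = u (Suc i) \<otimes> y \<Longrightarrow> y \<in> {\<one>, h}"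
      using ex[OF cr0] by blast
    \<comment> \<open>The segment lies in \<open>{\<one>, h}\<close> and so commutes with
      \<open>h\<close>; stripping off the letters \<open>x\<close>, \<open>inv x\<close> forces its
      one remaining letter to commute with \<open>h\<close> as well.\<close>
    have cent: "centralizes y" if "y \<in> carrier G" "u (Suc j) = u (Suc i) \<otimes> y" for y
      using seg[OF that] that(1) by (auto simp: centralizes_def)
    have not_cent: "\<not> centralizes (s k)" if "even k" for k
      using s_even[OF that] nc gc centralizes_inv[of "inv g"] by (auto simp: centralizes_def)
    show False
    proof (cases "even i")
      case ev: True
      have s1: "s (Suc i) = x" using cr_even[OF ev] ij by simp
      define a where "a = s (Suc (Suc i))"
      have a: "a \<in> carrier G" "\<not> centralizes a" using sc not_cent ev by (auto simp: a_def)
      have "\<not> cr (Suc i)" using cr_odd[of "Suc i"] ev s1 x_ne by auto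
      then have "j \<noteq> Suc i" using ij by auto
      then consider "j = Suc (Suc i)" | "j = Suc (Suc (Suc i))"
        | "Suc (Suc (Suc i)) < j" using ij(1) by linarith
      then show False
      proof cases
        case 1
        have "u (Suc j) = u (Suc i) \<otimes> (x \<otimes> a)"
          using uc xc a by (simp add: 1 u[of "Suc i"] u[of "Suc (Suc i)"] s1 a_def[symmetric] m_assoc)
        then have "centralizes (x \<otimes> a)" using cent xc a by simp
        then have "centralizes (inv x \<otimes> (x \<otimes> a))" using x_cent centralizes_mult by blast
        then show False using xc a by simp
      next
        case 2
        then have s3: "s (Suc (Suc (Suc i))) = inv x" using cr_odd[of j] ij(3) ev by simp
        have "u (Suc j) = u (Suc i) \<otimes> (x \<otimes> (a \<otimes> inv x))"
          using uc xc a
          by (simp add: 2 u[of "Suc i"] u[of "Suc (Suc i)"] u[of "Suc (Suc (Suc i))"] s1 s3 a_def[symmetric] m_assoc)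
        then have "centralizes (x \<otimes> (a \<otimes> inv x))" using cent xc a by simp
        then have "centralizes (inv x \<otimes> (x \<otimes> (a \<otimes> inv x)) \<otimes> x)" using x_cent centralizes_mult by blast
        then show False using xc a by (simp add: m_assoc)
      next
        case 3
        then have "\<not> cr (Suc (Suc i))" "\<not> cr (Suc (Suc (Suc i)))" using ij(4) by simp_all
        then show False using cr_even[of "Suc (Suc i)"] cr_odd[of "Suc (Suc (Suc i))"] ev
            s_odd[of "Suc (Suc (Suc i))"] by simp
      qed
    next
      case odd: False
      define a where "a = s (Suc i)"
      have a: "a \<in> carrier G" "\<not> centralizes a" using sc not_cent odd by (auto simp: a_def)
      consider "j = Suc i" | "j = Suc (Suc i)" | "Suc (Suc i) < j" using ij(1) by linarith
      then show False
      proof cases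
        case 1
        then show False using cent[OF a(1)] a(2) u[of "Suc i"] by (simp add: a_def)
      next
        case 2
        then have s2: "s (Suc (Suc i)) = inv x" using cr_odd[of j] ij(3) odd by simp
        have "u (Suc j) = u (Suc i) \<otimes> (a \<otimes> inv x)"
          using uc xc a by (simp add: 2 u[of "Suc i"] u[of "Suc (Suc i)"] s2 a_def[symmetric] m_assoc)
        then have "centralizes (a \<otimes> inv x)" using cent xc a by simp
        then have "centralizes (a \<otimes> inv x \<otimes> x)" using x_cent centralizes_mult by blast
        then show False using xc a by (simp add: m_assoc)
      next
        case 3
        then have "\<not> cr (Suc i)" "\<not> cr (Suc (Suc i))" using ij(4) by simp_all
        then show False using cr_even[of "Suc i"] cr_odd[of "Suc (Suc i)"] odd
            s_odd[of "Suc (Suc i)"] by simp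
      qed
    qed
  qed
qed

end

section \<open>From centrality on generators to normality\<close>

theorem theorem6p3:
  fixes G :: "('a, 'b) monoid_scheme" and S :: "'a set" and n r :: nat and h :: 'a
  assumes "group G"
    and "1 \<le> n"
    and "nilpotent_le G n"
    and "S \<subseteq> carrier G - {\<one>\<^bsub>G\<^esub>}"
    and "\<forall>s\<in>S. inv\<^bsub>G\<^esub> s \<in> S"
    and "generate G S = carrier G"
    and "2 ^ (n + 2) \<le> r" and "10 \<le> r"
    and "h \<in> S"
    and "local_2_separator (cay_adj G S) r \<one>\<^bsub>G\<^esub> h"
    and "\<forall>v\<in>carrier G. \<not> local_cutvertex (cay_adj G S) r v"
    and "h \<otimes>\<^bsub>G\<^esub> h = \<one>\<^bsub>G\<^esub>"
  shows "generate G {h} \<lhd> G"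
proof -
  interpret group G by fact
  interpret nilpotent_cayley G S h r n
    by unfold_locales (use assms in auto)
  obtain a b where ab: "a \<in> nbhd E {\<one>\<^bsub>G\<^esub>, h}" "b \<in> nbhd E {\<one>\<^bsub>G\<^esub>, h}"
    "\<not> (conn_adj E r \<one>\<^bsub>G\<^esub> h)\<^sup>*\<^sup>* a b"
    using assms(10) by (auto simp: local_2_separator_def)
  have "s \<otimes>\<^bsub>G\<^esub> h = h \<otimes>\<^bsub>G\<^esub> s" if "s \<in> S" for s
    using separator_imp_central[OF ab, of s] that by (cases "s = h") auto
  then have central: "x \<otimes>\<^bsub>G\<^esub> h = h \<otimes>\<^bsub>G\<^esub> x" if "x \<in> carrier G" for x
    using generate_commute[of S h x] assms(4,6) that by (simp add: subset_Diff_insert)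
  have commute: "y \<otimes>\<^bsub>G\<^esub> x = x \<otimes>\<^bsub>G\<^esub> y" if "x \<in> carrier G" "y \<in> generate G {h}" for x y
    using generate_commute[of "{h}" x y] central that by auto
  have "x \<otimes>\<^bsub>G\<^esub> y \<otimes>\<^bsub>G\<^esub> inv\<^bsub>G\<^esub> x \<in> generate G {h}"
    if xy: "x \<in> carrier G" "y \<in> generate G {h}" for x y
  proof -
    have "y \<in> carrier G" using generate_in_carrier[of "{h}" y] xy by auto
    then show ?thesis using xy by (simp add: commute[OF xy, symmetric] m_assoc)
  qed
  then show ?thesis
    using generate_is_subgroup[of "{h}"] h_carrier unfolding normal_inv_iff by blast
qed

end
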